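(* Let $\Gamma$ be a countably infinite discrete group. If $(\mathcal{F}_n)_{n\in\mathbb{N}}$ is a sequence of unbounded families of finite subsets of $\Gamma$, then there exists a free $\Gamma$-flow that is $\mathcal{F}_n$-minimal for all $n\in\mathbb{N}$.
   Context: A $\Gamma$-flow is a nonempty compact Hausdorff space $X$ equipped with a continuous action of $\Gamma$. It is free if $\gamma\cdot x\neq x$ for all $x\in X$ and all non-identity $\gamma\in\Gamma$. Given an action of $\Gamma$ on a set $X$ and a finite set $F\subset\Gamma$, a set $U\subseteq X$ is $F$-syndetic if $F^{-1}\cdot U=X$, i.e., for each $x\in X$ there is $\sigma\in F$ with $\sigma\cdot x\in U$. For a family $\mathcal{F}$ of finite subsets of $\Gamma$, a $\Gamma$-flow $X$ is $\mathcal{F}$-minimal if for every nonempty open set $U\subseteq X$ there is $F\in\mathcal{F}$ such that $U$ is $F$-syndetic. A family $\mathcal{F}$ of finite sets is unbounded if $\sup_{F\in\mathcal{F}}|F|=\infty$. *)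

theory Defs
  imports "HOL-Analysis.Analysis" "HOL-Algebra.Group_Action" "HOL-Library.Extended_Nat"
begin

text \<open>The flow lives on an abstract topology \<open>X\<close>, with underlying set \<^term>\<open>topspace X\<close>. The acting
  group is discrete, so continuity of the action is joint continuity from
  \<^term>\<open>prod_topology (discrete_topology (carrier G)) X\<close>.\<close>

locale flow = group_action G "topspace X" \<phi>
  for G :: "('g, 'm) monoid_scheme" (structure) and X :: "'x topology" and \<phi> :: "'g \<Rightarrow> 'x \<Rightarrow> 'x" +
  assumes nonempty: "topspace X \<noteq> {}"
    and compact: "compact_space X"
    and Hausdorff: "Hausdorff_space X"
    and continuous_action:
      "continuous_map (prod_topology (discrete_topology (carrier G)) X) X (\<lambda>(\<gamma>, x). \<phi> \<gamma> x)"

definition free_action :: "('g, 'm) monoid_scheme \<Rightarrow> 'x set \<Rightarrow> ('g \<Rightarrow> 'x \<Rightarrow> 'x) \<Rightarrow> bool" where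
  "free_action G E \<phi> \<longleftrightarrow>
     (\<forall>x\<in>E. \<forall>\<gamma>\<in>carrier G. \<gamma> \<noteq> \<one>\<^bsub>G\<^esub> \<longrightarrow> \<phi> \<gamma> x \<noteq> x)"

definition syndetic ::
    "('g, 'm) monoid_scheme \<Rightarrow> 'x set \<Rightarrow> ('g \<Rightarrow> 'x \<Rightarrow> 'x) \<Rightarrow> 'g set \<Rightarrow> 'x set \<Rightarrow> bool" where
  "syndetic G E \<phi> F U \<longleftrightarrow> (\<Union>\<sigma>\<in>F. \<phi> (inv\<^bsub>G\<^esub> \<sigma>) ` U) = E"

lemma (in group_action) syndetic_iff:
  assumes "F \<subseteq> carrier G" "U \<subseteq> E"
  shows "syndetic G E \<phi> F U \<longleftrightarrow> (\<forall>x\<in>E. \<exists>\<sigma>\<in>F. \<phi> \<sigma> x \<in> U)"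
proof -
  have G: "group G"
    using group_hom group_hom.axioms(1) by blast
  have "x \<in> \<phi> (inv \<sigma>) ` U \<longleftrightarrow> \<phi> \<sigma> x \<in> U" if "x \<in> E" "\<sigma> \<in> F" for x \<sigma>
  proof
    assume "x \<in> \<phi> (inv \<sigma>) ` U"
    then obtain u where "u \<in> U" "x = \<phi> (inv \<sigma>) u" by blast
    then show "\<phi> \<sigma> x \<in> U"
      using assms that orbit_sym_aux[of "inv \<sigma>" u x] G
      by (metis group.inv_closed group.inv_inv subsetD)
  next
    assume "\<phi> \<sigma> x \<in> U"
    moreover have "\<phi> (inv \<sigma>) (\<phi> \<sigma> x) = x"
      using assms that orbit_sym_aux by blast
    ultimately show "x \<in> \<phi> (inv \<sigma>) ` U" by force
  qed
  moreover have "\<phi> (inv \<sigma>) ` U \<subseteq> E" if "\<sigma> \<in> F" for \<sigma>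
    using assms that G element_image group.inv_closed by (metis image_subsetI subsetD)
  ultimately show ?thesis
    unfolding syndetic_def by blast
qed

definition family_minimal ::
    "('g, 'm) monoid_scheme \<Rightarrow> 'x topology \<Rightarrow> ('g \<Rightarrow> 'x \<Rightarrow> 'x) \<Rightarrow> 'g set set \<Rightarrow> bool" where
  "family_minimal G X \<phi> \<F> \<longleftrightarrow>
     (\<forall>U. openin X U \<and> U \<noteq> {} \<longrightarrow> (\<exists>F\<in>\<F>. syndetic G (topspace X) \<phi> F U))"

definition unbounded_family :: "'g set set \<Rightarrow> bool" where
  "unbounded_family \<F> \<longleftrightarrow> (SUP F\<in>\<F>. enat (card F)) = \<infinity>"

text \<open>HOL cannot quantify existentially over types, so the existence of a flow has to name a type
  containing its points; the type \<open>'g \<Rightarrow> nat \<Rightarrow> real\<close> loses no generality. Freeness of a flow of a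
  countable group is witnessed by countably many continuous \<open>[0,1]\<close>-valued functions (finitely many
  for each group element, by compactness), so every free flow has a free metrizable factor; its
  points embed into \<open>([0,1]\<^sup>\<nat>)\<^sup>\<Gamma>\<close>. Minimality with respect to a family passes to factors. The
  topology and the action on this set of points remain arbitrary.\<close>

type_synonym 'g point = "'g \<Rightarrow> nat \<Rightarrow> real"

end

theory Submission
  imports Defs
begin

text \<open>The flow is the orbit closure of a single point \<open>z\<close>, a function that assigns to each group element
  a sequence of colours \<open>0\<close>, \<open>1\<close>, \<open>2\<close>; a group element \<open>g\<close> moves \<open>x\<close> to \<open>u \<mapsto> x (u g)\<close>. Let \<open>\<gamma> l\<close>
  enumerate the non-identity elements.

  Freeness is forced locally: the \<open>l\<close>-th coordinate of \<open>z\<close> is a proper colouring of the graph that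
  joins \<open>u\<close> to \<open>\<gamma> l u\<close>. This closed invariant condition holds on the whole orbit closure, and a point
  fixed by \<open>\<gamma> l\<close> would give \<open>1\<close> and \<open>\<gamma> l\<close> the same colour. Three colours suffice because
  the graph has degree at most two, so every finite partial proper colouring can be extended.

  Minimality asks that finite patterns of \<open>z\<close> recur: the pattern \<open>p k\<close> of \<open>z\<close> on the finite window
  \<open>V k\<close> must occur at some point of \<open>F h\<close> for every \<open>h\<close>, where \<open>F\<close> is a subset of a translate of a
  member of one of the given families. The patterns \<open>p 0\<close>, \<open>p 1\<close>, ... are built one after the other, each
  extending the one before, and \<open>F\<close> is selected once \<open>p k\<close> is known. The difficulty is that all later
  windows have to respect this choice. The invariant (\<open>robust\<close>) is that a translate \<open>F g\<close> is
  already hit by an occurrence of \<open>p k\<close> inside a later window as soon as more than half of it is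
  blocked, in the sense that a copy of \<open>p k\<close> placed there would come too close to that window.
  Once the windows have swallowed \<open>F g\<close>, this says that \<open>p k\<close> occurs on it.

  To enlarge a window by one point (\<open>extend_tower\<close>), copies of \<open>p k\<close>, then of \<open>p (k - 1)\<close>, and so on
  down to \<open>p 0\<close> are placed around it, each time along a set that meets all translates of the
  corresponding \<open>F\<close> with enough unblocked points, and only the finitely many copies near the window
  are kept. Two features keep the invariant. The copies of one level are so sparse that they alone
  never block more than half of a translate; a translate blocked by the new window is
  therefore close to what was there before, and the copy that was placed on it is among those kept. And copies
  of higher levels are so far apart that a translate can be blocked by just one of them, where
  the invariant of that copy applies.

  Sets that are sparse, separated and hit all translates of \<open>F\<close> exist for every large
  well-spread \<open>F\<close> (\<open>sparse_hitting_set\<close>): colour the group at random with many colours and take the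
  isolated points of colour \<open>0\<close>. Failure has probability exponentially small in the size of \<open>F\<close>,
  whereas each point is involved in few events, so the Lovasz local lemma applies. It is used in a
  counting form (\<open>counting_local_lemma\<close>) that has a short direct proof.\<close>

section \<open>A counting form of the local lemma\<close>

text \<open>A function on a union of blocks is determined by its restrictions to the blocks, so the
  bounds for the single blocks multiply.\<close>

lemma card_product_patterns_le:
  fixes blk :: "'i \<Rightarrow> 'v set" and C :: "'c set" and Z :: "'i \<Rightarrow> ('v \<Rightarrow> 'c) set"
  assumes "finite X" and "\<And>i. i \<in> X \<Longrightarrow> finite (Z i) \<and> card (Z i) \<le> z"
  shows "finite {f \<in> (\<Union>i\<in>X. blk i) \<rightarrow>\<^sub>E C. \<forall>i\<in>X. restrict f (blk i) \<in> Z i}" (is "finite ?B")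
    and "card {f \<in> (\<Union>i\<in>X. blk i) \<rightarrow>\<^sub>E C. \<forall>i\<in>X. restrict f (blk i) \<in> Z i} \<le> z ^ card X"
proof -
  let ?h = "\<lambda>f. \<lambda>i\<in>X. restrict f (blk i)"
  have inj: "inj_on ?h ?B"
  proof (rule inj_onI)
    fix f g assume f: "f \<in> ?B" and g: "g \<in> ?B" and eq: "?h f = ?h g"
    show "f = g"
    proof
      fix x
      show "f x = g x"
      proof (cases "\<exists>i\<in>X. x \<in> blk i")
        case True
        then obtain i where i: "i \<in> X" "x \<in> blk i" by blast
        from fun_cong[OF eq, of i] i have "restrict f (blk i) = restrict g (blk i)" by simp
        from fun_cong[OF this, of x] i show ?thesis by simp
      next
        case False
        then show ?thesis using f g by (auto simp: PiE_def extensional_def)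
      qed
    qed
  qed
  have sub: "?h ` ?B \<subseteq> PiE X Z" by auto
  have fin: "finite (PiE X Z)" using assms by (intro finite_PiE) auto
  show "finite ?B" using inj sub fin by (meson finite_imageD finite_subset)
  have "card ?B \<le> card (PiE X Z)" using card_inj_on_le[OF inj sub fin] .
  also have "\<dots> = (\<Prod>i\<in>X. card (Z i))" using assms by (simp add: card_PiE)
  also have "\<dots> \<le> (\<Prod>i\<in>X. z)" using assms by (intro prod_mono) auto
  finally show "card ?B \<le> z ^ card X" by simp
qed

text \<open>Colourings are built up one vertex at a time, and the invariant is that one more vertex multiplies
  the number of good colourings by at least \<open>\<beta>\<close>. Of the \<open>card C\<close> possible extensions those are lost that
  complete some bad pattern on a set \<open>T j\<close> containing the new vertex. Such an extension consists of
  a bad pattern on \<open>T j\<close> and a good colouring of the rest, and by the invariant the good colourings of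
  the rest are fewer by a factor \<open>\<beta> ^ (card (T j) - 1)\<close>. The hypothesis bounds the total loss by
  \<open>card C - \<beta>\<close>.\<close>

lemma counting_local_lemma:
  fixes T :: "'j \<Rightarrow> 'v set" and C :: "'c set" and bad :: "'j \<Rightarrow> ('v \<Rightarrow> 'c) set" and \<beta> :: real
  assumes fin: "finite \<Omega>" "finite C" "finite J"
    and T: "\<And>j. j \<in> J \<Longrightarrow> T j \<subseteq> \<Omega>"
    and T_ne: "\<And>j. j \<in> J \<Longrightarrow> T j \<noteq> {}"
    and bad_fin: "\<And>j. j \<in> J \<Longrightarrow> finite (bad j)"
    and \<beta>: "\<beta> > 0"
    and weight: "\<And>v. v \<in> \<Omega> \<Longrightarrow>
      (\<Sum>j\<in>{j\<in>J. v \<in> T j}. real (card (bad j)) / \<beta> ^ (card (T j) - 1)) \<le> real (card C) - \<beta>"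
  shows "\<exists>f \<in> \<Omega> \<rightarrow>\<^sub>E C. \<forall>j\<in>J. restrict f (T j) \<notin> bad j"
proof -
  define Good where "Good V = {f \<in> V \<rightarrow>\<^sub>E C. \<forall>j\<in>J. T j \<subseteq> V \<longrightarrow> restrict f (T j) \<notin> bad j}" for V
  define N where "N V = real (card (Good V))" for V
  have finGood: "finite (Good V)" if "V \<subseteq> \<Omega>" for V
    unfolding Good_def using fin that
    by (intro finite_subset[OF _ finite_PiE[of V "\<lambda>_. C"]]) (auto intro: finite_subset)
  have step: "N (insert v V) \<ge> \<beta> * N V"
    if sub: "insert v V \<subseteq> \<Omega>" and v: "v \<notin> V"
      and IH: "\<And>V' w. insert w V' \<subseteq> \<Omega> \<Longrightarrow> w \<notin> V' \<Longrightarrow> card V' < card V \<Longrightarrow> N (insert w V') \<ge> \<beta> * N V'"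
    for v V
  proof -
    have finV: "finite V" using sub fin by (meson finite_subset insert_subset)
    \<comment> \<open>the invariant iterated: removing \<open>card D\<close> vertices costs at least that many factors \<open>\<beta>\<close>\<close>
    have pow: "N V \<ge> \<beta> ^ card D * N (V - D)" if "D \<subseteq> V" for D
    proof -
      have "finite D" using that finV finite_subset by blast
      then show ?thesis using that
      proof (induction D rule: finite_induct)
        case empty then show ?case by simp
      next
        case (insert d D)
        have e: "insert d (V - insert d D) = V - D" using insert by auto
        have "card (V - insert d D) < card V"
          using insert finV by (intro psubset_card_mono) auto
        then have "N (V - D) \<ge> \<beta> * N (V - insert d D)"
          using IH[of d "V - insert d D"] e \<open>insert v V \<subseteq> \<Omega>\<close> by auto
        then have "\<beta> ^ card D * N (V - D) \<ge> \<beta> ^ card D * (\<beta> * N (V - insert d D))"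
          using \<beta> by (intro mult_left_mono) auto
        then show ?case using insert by (simp add: mult.assoc mult.left_commute)
      qed
    qed
    let ?J = "{j\<in>J. v \<in> T j \<and> T j \<subseteq> insert v V}"
    let ?W = "insert v V"
    let ?Ext = "{f \<in> ?W \<rightarrow>\<^sub>E C. restrict f V \<in> Good V}"
    let ?Bad = "\<lambda>j. {f \<in> ?Ext. restrict f (T j) \<in> bad j}"
    have finExt: "finite ?Ext"
      using fin finV by (intro finite_subset[OF _ finite_PiE[of ?W "\<lambda>_. C"]]) auto
    have cExt: "card ?Ext = card C * card (Good V)"
    proof -
      have "bij_betw (\<lambda>(c, f). f(v := c)) (C \<times> Good V) ?Ext"
      proof (rule bij_betwI[where g = "\<lambda>f. (f v, restrict f V)"])
        show "(\<lambda>(c, f). f(v := c)) \<in> C \<times> Good V \<rightarrow> ?Ext"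
        proof (clarsimp)
          fix c f assume "c \<in> C" "f \<in> Good V"
          moreover have "restrict (f(v := c)) V = f"
            using \<open>f \<in> Good V\<close> \<open>v \<notin> V\<close> by (auto simp: Good_def fun_eq_iff PiE_def extensional_def restrict_def)
          moreover have "f(v := c) \<in> ?W \<rightarrow>\<^sub>E C"
            using calculation by (intro PiE_fun_upd) (auto simp: Good_def)
          ultimately show "f(v := c) \<in> ?W \<rightarrow>\<^sub>E C \<and> restrict (f(v := c)) V \<in> Good V"
            by simp
        qed
        show "(\<lambda>f. (f v, restrict f V)) \<in> ?Ext \<rightarrow> C \<times> Good V" by auto
        show "(\<lambda>f. (f v, restrict f V)) ((\<lambda>(c, f). f(v := c)) x) = x" if "x \<in> C \<times> Good V" for x
          using that \<open>v \<notin> V\<close> by (auto simp: Good_def fun_eq_iff PiE_def extensional_def restrict_def)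
        show "(\<lambda>(c, f). f(v := c)) (f v, restrict f V) = f" if "f \<in> ?Ext" for f
          using that by (auto simp: fun_eq_iff PiE_def extensional_def restrict_def)
      qed
      from bij_betw_same_card[OF this] show ?thesis by (simp add: card_cartesian_product)
    qed
    have cover: "?Ext \<subseteq> Good ?W \<union> (\<Union>j\<in>?J. ?Bad j)"
    proof
      fix f assume f: "f \<in> ?Ext"
      show "f \<in> Good ?W \<union> (\<Union>j\<in>?J. ?Bad j)"
      proof (cases "f \<in> Good ?W")
        case False
        then obtain j where j: "j \<in> J" "T j \<subseteq> ?W" "restrict f (T j) \<in> bad j"
          using f by (auto simp: Good_def)
        have "v \<in> T j"
        proof (rule ccontr)
          assume "v \<notin> T j"
          then have "T j \<subseteq> V" using j by auto
          then have "restrict (restrict f V) (T j) = restrict f (T j)"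
            by (auto simp: fun_eq_iff restrict_def)
          then show False using f j \<open>T j \<subseteq> V\<close> by (auto simp: Good_def)
        qed
        then show ?thesis using f j by blast
      qed simp
    qed
    have badcount: "real (card (?Bad j)) \<le> N V * (real (card (bad j)) / \<beta> ^ (card (T j) - 1))"
      if j: "j \<in> ?J" for j
    proof -
      let ?D = "T j - {v}"
      let ?h = "\<lambda>f. (restrict f (V - ?D), restrict f (T j))"
      have jJ: "j \<in> J" using j by simp
      have finT: "finite (T j)" using T[OF jJ] fin finite_subset by blast
      have inj: "inj_on ?h (?Bad j)"
      proof (rule inj_onI)
        fix f g assume f: "f \<in> ?Bad j" and g: "g \<in> ?Bad j" and eq: "?h f = ?h g"
        show "f = g"
        proof
          fix x
          have 1: "restrict f (V - ?D) x = restrict g (V - ?D) x" and 2: "restrict f (T j) x = restrict g (T j) x"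
            using eq by (auto dest: fun_cong)
          show "f x = g x"
          proof (cases "x \<in> ?W")
            case True
            then show ?thesis using 1 2 j by (cases "x \<in> T j") (auto simp: restrict_def)
          next
            case False
            then show ?thesis using f g by (auto simp: PiE_def extensional_def)
          qed
        qed
      qed
      have img: "?h ` ?Bad j \<subseteq> Good (V - ?D) \<times> bad j"
      proof (rule image_subsetI)
        fix f assume "f \<in> ?Bad j"
        then have f: "f \<in> ?W \<rightarrow>\<^sub>E C" "restrict f V \<in> Good V" "restrict f (T j) \<in> bad j" by auto
        have "restrict f (V - ?D) \<in> Good (V - ?D)"
          unfolding Good_def
        proof (intro CollectI conjI ballI impI)
          show "restrict f (V - ?D) \<in> V - ?D \<rightarrow>\<^sub>E C" using f by auto
          fix i assume i: "i \<in> J" "T i \<subseteq> V - ?D"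
          have e: "restrict (restrict f (V - ?D)) (T i) = restrict (restrict f V) (T i)"
            using i by (auto simp: fun_eq_iff restrict_def)
          show "restrict (restrict f (V - ?D)) (T i) \<notin> bad i"
            unfolding e using f i by (auto simp: Good_def)
        qed
        with f show "?h f \<in> Good (V - ?D) \<times> bad j" by simp
      qed
      have "V - ?D \<subseteq> \<Omega>" using \<open>insert v V \<subseteq> \<Omega>\<close> by auto
      then have "finite (Good (V - ?D) \<times> bad j)" using finGood bad_fin[OF jJ] by auto
      then have "card (?Bad j) \<le> card (Good (V - ?D) \<times> bad j)"
        using card_inj_on_le[OF inj img] by blast
      then have le: "real (card (?Bad j)) \<le> N (V - ?D) * real (card (bad j))"
        unfolding N_def card_cartesian_product by (simp flip: of_nat_mult)
      have "?D \<subseteq> V" using j by auto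
      from pow[OF this] have "N (V - ?D) \<le> N V / \<beta> ^ card ?D"
        using \<beta> by (simp add: field_simps)
      moreover have "card ?D = card (T j) - 1" using j finT by simp
      ultimately have "N (V - ?D) \<le> N V / \<beta> ^ (card (T j) - 1)" by simp
      then have "N (V - ?D) * real (card (bad j)) \<le> N V / \<beta> ^ (card (T j) - 1) * real (card (bad j))"
        by (intro mult_right_mono) auto
      with le show ?thesis by simp
    qed
    have finJ: "finite ?J" using fin by simp
    have "card ?Ext \<le> card (Good ?W) + card (\<Union>j\<in>?J. ?Bad j)"
      using card_mono[OF _ cover] card_Un_le[of "Good ?W" "\<Union>j\<in>?J. ?Bad j"] finJ finExt
        finGood[OF \<open>insert v V \<subseteq> \<Omega>\<close>] by fastforce
    also have "card (\<Union>j\<in>?J. ?Bad j) \<le> (\<Sum>j\<in>?J. card (?Bad j))"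
      using finJ by (rule card_UN_le)
    finally have "real (card ?Ext) \<le> N ?W + (\<Sum>j\<in>?J. real (card (?Bad j)))"
      unfolding N_def by (simp flip: of_nat_sum of_nat_add)
    also have "(\<Sum>j\<in>?J. real (card (?Bad j))) \<le> (\<Sum>j\<in>?J. N V * (real (card (bad j)) / \<beta> ^ (card (T j) - 1)))"
      using badcount by (rule sum_mono)
    also have "\<dots> = N V * (\<Sum>j\<in>?J. real (card (bad j)) / \<beta> ^ (card (T j) - 1))"
      by (simp add: sum_distrib_left)
    also have "\<dots> \<le> N V * (\<Sum>j\<in>{j\<in>J. v \<in> T j}. real (card (bad j)) / \<beta> ^ (card (T j) - 1))"
      using fin \<beta> by (intro mult_left_mono sum_mono2) (auto simp: N_def)
    also have "\<dots> \<le> N V * (real (card C) - \<beta>)"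
      using weight sub by (intro mult_left_mono) (auto simp: N_def)
    finally show ?thesis unfolding cExt by (simp add: N_def algebra_simps)
  qed
  have grow: "N (insert v V) \<ge> \<beta> * N V" if "insert v V \<subseteq> \<Omega>" "v \<notin> V" for v V
    using that
  proof (induction "card V" arbitrary: v V rule: less_induct)
    case less
    show ?case using step[OF less.prems] less.hyps by blast
  qed
  have pos: "N V > 0" if "V \<subseteq> \<Omega>" for V
  proof -
    have "finite V" using that fin finite_subset by blast
    then show ?thesis using that
    proof (induction V rule: finite_induct)
      case empty
      have "Good {} = {\<lambda>_. undefined}" unfolding Good_def using T_ne by auto
      then show ?case by (simp add: N_def)
    next
      case (insert v V)
      then have "0 < \<beta> * N V" using \<beta> by auto
      then show ?case using grow[of v V] insert by force
    qed
  qed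
  have "Good \<Omega> \<noteq> {}" using pos[of \<Omega>] by (auto simp: N_def)
  then show ?thesis unfolding Good_def using T by blast
qed

section \<open>Random colours on blocks\<close>

text \<open>The parameters for the random colouring in \<open>sparse_hitting_set\<close>. Blocks have \<open>a\<close> points and the
  sets \<open>F\<close> have \<open>4 t\<close> points. The first summand bounds the loss from \<open>t\<close> blocks that all contain the
  colour \<open>0\<close>, with \<open>2 ^ (4 t)\<close> for the selection of these blocks; with \<open>q = 64 a\<close> colours
  this makes a factor of at most \<open>1 / 2\<close> for each of the \<open>t\<close> blocks. The second summand
  bounds the loss from \<open>2 t\<close> blocks none of which has its only \<open>0\<close> in the centre. Both decay exponentially in \<open>t\<close> once \<open>\<beta>\<close> is so close to \<open>q\<close> that
  replacing \<open>q\<close> by \<open>\<beta>\<close> costs each block less than it gains.\<close>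

lemma local_lemma_parameters:
  fixes a :: nat
  assumes "a \<ge> 1"
  defines "q \<equiv> 64 * real a"
  shows "\<exists>(\<beta>::real) t. 0 < \<beta> \<and> \<beta> < q \<and> a \<le> t \<and>
     4 * real t * real a * 2 ^ (4*t) * ((real a * q ^ (a-1)) ^ t / \<beta> ^ (a*t - 1)) +
     4 * real t * real a * ((q ^ a - (q-1) ^ (a-1)) ^ (2*t) / \<beta> ^ (a*(2*t) - 1)) \<le> q - \<beta>"
proof -
  have q: "q \<ge> 64" using assms by simp
  define z where "z = q ^ a - (q-1) ^ (a-1)"
  have qa: "q ^ a = q * q ^ (a-1)" using assms by (cases a) auto
  have "(q-1) ^ (a-1) \<le> q ^ (a-1)" using q by (intro power_mono) auto
  also have "\<dots> \<le> q ^ a" unfolding qa using q mult_right_mono[of 1 q "q^(a-1)"] by simp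
  finally have z0: "z \<ge> 0" by (simp add: z_def)
  have z1: "z < q ^ a" unfolding z_def using q by simp
  have "((\<lambda>x. x ^ a) \<longlongrightarrow> q ^ a) (at_left q)"
    by (intro tendsto_intros)
  moreover have "max z (q ^ a / 2) < q ^ a" using z1 q by auto
  ultimately have ev: "eventually (\<lambda>x. x ^ a > max z (q ^ a / 2)) (at_left q)"
    by (rule order_tendstoD)
  have "eventually (\<lambda>x. x > 0 \<and> x < q) (at_left q)"
    using eventually_at_left_real[of 0 q] q by auto
  with ev have "eventually (\<lambda>x. x ^ a > max z (q ^ a / 2) \<and> x > 0 \<and> x < q) (at_left q)"
    by eventually_elim auto
  then obtain \<beta> where \<beta>: "\<beta> ^ a > z" "\<beta> ^ a > q ^ a / 2" "\<beta> > 0" "\<beta> < q"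
    using eventually_happens[of _ "at_left q"] by force
  define \<rho> where "\<rho> = (z / \<beta> ^ a) ^ 2"
  have \<rho>: "0 \<le> \<rho>" "\<rho> < 1"
    using \<beta> z0 by (auto simp: \<rho>_def power2_eq_square divide_simps intro!: mult_strict_mono)
  have l1: "(\<lambda>t. real t * (1/2) ^ t) \<longlonglongrightarrow> 0" by (rule powser_times_n_limit_0) simp
  have l2: "(\<lambda>t. real t * \<rho> ^ t) \<longlonglongrightarrow> 0" by (rule powser_times_n_limit_0) (use \<rho> in simp)
  have "(\<lambda>t. 4 * real a * \<beta> * (real t * (1/2) ^ t + real t * \<rho> ^ t)) \<longlonglongrightarrow> 4 * real a * \<beta> * (0 + 0)"
    by (intro tendsto_intros l1 l2)
  then have "eventually (\<lambda>t. 4 * real a * \<beta> * (real t * (1/2) ^ t + real t * \<rho> ^ t) < q - \<beta>) sequentially"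
    using \<beta> by (intro order_tendstoD) auto
  then obtain t0 where t0: "\<And>t. t \<ge> t0 \<Longrightarrow> 4 * real a * \<beta> * (real t * (1/2) ^ t + real t * \<rho> ^ t) < q - \<beta>"
    unfolding eventually_sequentially by blast
  define t where "t = max t0 a"
  have t: "t \<ge> a" "t \<ge> 1" and tb: "4 * real a * \<beta> * (real t * (1/2) ^ t + real t * \<rho> ^ t) < q - \<beta>"
    using t0[of t] assms by (auto simp: t_def)
  have shift: "x / \<beta> ^ (n - 1) = \<beta> * (x / \<beta> ^ n)" if "n \<ge> 1" for x n
    using that \<beta> by (cases n) auto
  have n1: "a * t \<ge> 1" "a * (2 * t) \<ge> 1" using t assms by auto
  have "2 ^ (4*t) * ((real a * q ^ (a-1)) ^ t / \<beta> ^ (a*t - 1))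
     = \<beta> * (16 * real a * q ^ (a-1) / \<beta> ^ a) ^ t"
    unfolding shift[OF n1(1)] by (simp add: power_mult power_mult_distrib power_divide)
  also have "\<dots> \<le> \<beta> * (1/2) ^ t"
  proof (intro mult_left_mono power_mono)
    have "q ^ a = 64 * real a * q ^ (a-1)" unfolding qa by (simp add: q_def)
    then have "32 * real a * q ^ (a-1) \<le> \<beta> ^ a" using \<beta>(2) by simp
    then show "16 * real a * q ^ (a-1) / \<beta> ^ a \<le> 1/2" using \<beta> by (simp add: field_simps)
  qed (use \<beta> q in auto)
  finally have b1: "2 ^ (4*t) * ((real a * q ^ (a-1)) ^ t / \<beta> ^ (a*t - 1)) \<le> \<beta> * (1/2) ^ t" .
  have b2: "z ^ (2*t) / \<beta> ^ (a*(2*t) - 1) = \<beta> * \<rho> ^ t"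
    unfolding shift[OF n1(2)] \<rho>_def by (simp add: power_mult[symmetric] power_divide mult_ac)
  have "4 * real t * real a * 2 ^ (4*t) * ((real a * q ^ (a-1)) ^ t / \<beta> ^ (a*t - 1)) +
      4 * real t * real a * (z ^ (2*t) / \<beta> ^ (a*(2*t) - 1)) \<le>
      4 * real t * real a * (\<beta> * (1/2) ^ t) + 4 * real t * real a * (\<beta> * \<rho> ^ t)"
    using mult_left_mono[OF b1, of "4 * real t * real a"] b2 by (simp add: mult.assoc)
  also have "\<dots> \<le> q - \<beta>" using tb by (simp add: algebra_simps)
  finally show ?thesis using \<beta> t unfolding z_def by blast
qed

lemma card_patterns_with_zero:
  assumes "finite D" "card D = a" "q \<ge> (1::nat)"
  shows "card {h \<in> D \<rightarrow>\<^sub>E {..<q}. \<exists>u\<in>D. h u = 0} \<le> a * q ^ (a-1)"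
proof -
  have "{h \<in> D \<rightarrow>\<^sub>E {..<q}. \<exists>u\<in>D. h u = 0} \<subseteq> (\<Union>u\<in>D. PiE D (\<lambda>w. if w = u then {0} else {..<q}))"
    by (auto simp: PiE_iff)
  then have "card {h \<in> D \<rightarrow>\<^sub>E {..<q}. \<exists>u\<in>D. h u = 0} \<le> card (\<Union>u\<in>D. PiE D (\<lambda>w. if w = u then {0} else {..<q}))"
    using assms by (intro card_mono finite_UN_I finite_PiE) auto
  also have "\<dots> \<le> (\<Sum>u\<in>D. card (PiE D (\<lambda>w. if w = u then {0} else {..<q})))"
    using assms by (intro card_UN_le)
  also have "\<dots> = (\<Sum>u\<in>D. q ^ (a-1))"
  proof (rule sum.cong)
    fix u assume u: "u \<in> D"
    have "card (PiE D (\<lambda>w. if w = u then {0} else {..<q})) = (\<Prod>w\<in>D. if w = u then 1 else q)"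
      using assms by (simp add: card_PiE if_distrib cong: if_cong)
    also have "\<dots> = (\<Prod>w\<in>D - {u}. if w = u then 1 else q)"
      using u assms by (subst prod.remove[of D u]) auto
    also have "\<dots> = (\<Prod>w\<in>D - {u}. q)" by (intro prod.cong) auto
    finally show "card (PiE D (\<lambda>w. if w = u then {0} else {..<q})) = q ^ (a-1)"
      using assms u by simp
  qed simp
  finally show ?thesis using assms by simp
qed

lemma card_patterns_not_isolated_zero:
  assumes "finite D" "card D = a" "v \<in> D" "q \<ge> (1::nat)"
  shows "real (card {h \<in> D \<rightarrow>\<^sub>E {..<q}. \<not> (h v = 0 \<and> (\<forall>u\<in>D - {v}. h u \<noteq> 0))})
    \<le> real q ^ a - (real q - 1) ^ (a-1)"
proof -
  let ?P = "PiE D (\<lambda>w. if w = v then {0} else {1..<q})"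
  have eq: "{h \<in> D \<rightarrow>\<^sub>E {..<q}. \<not> (h v = 0 \<and> (\<forall>u\<in>D - {v}. h u \<noteq> 0))} = (D \<rightarrow>\<^sub>E {..<q}) - ?P"
  proof -
    have "(\<forall>w\<in>D. h w \<in> (if w = v then {0} else {1..<q})) \<longleftrightarrow>
        (\<forall>w\<in>D. h w < q) \<and> h v = 0 \<and> (\<forall>u\<in>D - {v}. h u \<noteq> 0)" (is "?l = ?r") for h
    proof
      assume l: ?l
      have "h w < q" if "w \<in> D" for w using bspec[OF l that] assms by (auto split: if_splits)
      moreover have "h v = 0" using bspec[OF l, of v] assms by simp
      moreover have "h u \<noteq> 0" if "u \<in> D - {v}" for u using bspec[OF l, of u] that by auto
      ultimately show ?r by blast
    qed (auto simp: Suc_le_eq)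
    note eqv = this
    show ?thesis
    proof (rule Set.set_eqI)
      fix h
      show "h \<in> {h \<in> D \<rightarrow>\<^sub>E {..<q}. \<not> (h v = 0 \<and> (\<forall>u\<in>D - {v}. h u \<noteq> 0))} \<longleftrightarrow> h \<in> (D \<rightarrow>\<^sub>E {..<q}) - ?P"
        using eqv[of h] by (simp only: mem_Collect_eq Diff_iff PiE_iff lessThan_iff) blast
    qed
  qed
  have sub: "?P \<subseteq> D \<rightarrow>\<^sub>E {..<q}" using assms by (intro PiE_mono) auto
  have fin: "finite (D \<rightarrow>\<^sub>E {..<q})" using assms by (intro finite_PiE) auto
  have "card ?P = (\<Prod>w\<in>D. if w = v then 1 else q - 1)"
    using assms by (simp add: card_PiE if_distrib cong: if_cong)
  also have "\<dots> = (\<Prod>w\<in>D - {v}. if w = v then 1 else q - 1)"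
    using assms by (subst prod.remove[of D v]) auto
  also have "\<dots> = (\<Prod>w\<in>D - {v}. q - 1)" by (intro prod.cong) auto
  finally have "card ?P = (q - 1) ^ (a-1)" using assms by simp
  moreover have "card (D \<rightarrow>\<^sub>E {..<q}) = q ^ a" using assms by (simp add: card_PiE)
  moreover have "card ?P \<le> card (D \<rightarrow>\<^sub>E {..<q})" using card_mono[OF fin sub] .
  ultimately show ?thesis unfolding eq
    using card_Diff_subset[OF finite_subset[OF sub fin] sub] assms
    by (simp add: of_nat_diff)
qed

section \<open>Sparse hitting sets in a group\<close>

context group
begin

lemma mem_translate: "x \<in> A #> g \<longleftrightarrow> (\<exists>a\<in>A. x = a \<otimes> g)"
  by (auto simp: r_coset_def)

lemma mem_set_mult: "x \<in> A <#> B \<longleftrightarrow> (\<exists>a\<in>A. \<exists>b\<in>B. x = a \<otimes> b)"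
  by (auto simp: set_mult_def)

lemma set_multI: "a \<in> A \<Longrightarrow> b \<in> B \<Longrightarrow> a \<otimes> b \<in> A <#> B"
  by (auto simp: mem_set_mult)

lemma finite_translate: "finite A \<Longrightarrow> finite (A #> g)"
  by (simp add: r_coset_def)

lemma finite_set_mult: "finite A \<Longrightarrow> finite B \<Longrightarrow> finite (A <#> B)"
  by (simp add: set_mult_def)

lemma card_translate:
  assumes "A \<subseteq> carrier G" "g \<in> carrier G"
  shows "card (A #> g) = card A"
proof -
  have "A #> g = (\<lambda>a. a \<otimes> g) ` A" by (auto simp: r_coset_def)
  moreover have "inj_on (\<lambda>a. a \<otimes> g) A" using inj_on_multc[OF assms(2)] assms(1) inj_on_subset by blast
  ultimately show ?thesis by (simp add: card_image)
qed

text \<open>The threshold \<open>t\<close> depends on \<open>E\<close> only, so it can be fixed before \<open>F\<close> is selected. The set \<open>S\<close> has to be \<open>E\<close>-separated, to avoid \<open>B\<close>,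
  to have a sparse neighbourhood in every translate of \<open>F\<close>, and to meet those translates of \<open>F\<close>
  that lie at least half outside \<open>B\<close>. It consists of the isolated points of colour \<open>0\<close> outside \<open>B\<close>
  in a colouring given by the local lemma. There are two kinds of events for a translate \<open>F g\<close>,
  marked by a Boolean in the proof: all of \<open>t\<close> given points have a \<open>0\<close> nearby, or none of \<open>2 t\<close>
  points outside \<open>B\<close> is an isolated \<open>0\<close>. The blocks \<open>E \<sigma> g\<close> for \<open>\<sigma> \<in> F\<close> are disjoint, so
  the conditions at the points of one translate concern disjoint sets of vertices.\<close>

lemma sparse_hitting_set:
  assumes E: "E \<subseteq> carrier G" "finite E" "\<one> \<in> E" "m_inv G ` E \<subseteq> E"
  shows "\<exists>t\<ge>card E. \<forall>F. finite F \<and> F \<subseteq> carrier G \<and> card F = 4 * t \<and>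
        (\<forall>\<sigma>\<in>F. \<forall>\<tau>\<in>F. \<sigma> \<noteq> \<tau> \<longrightarrow> (E #> \<sigma>) \<inter> (E #> \<tau>) = {}) \<longrightarrow>
      (\<forall>B Q. finite Q \<and> Q \<subseteq> carrier G \<longrightarrow>
        (\<exists>S. finite S \<and> S \<subseteq> carrier G - B \<and>
          (\<forall>s\<in>S. \<forall>s'\<in>S. s \<noteq> s' \<longrightarrow> s' \<notin> E #> s) \<and>
          (\<forall>g\<in>carrier G. card ((F #> g) \<inter> (E <#> S)) \<le> t) \<and>
          (\<forall>g\<in>Q. card ((F #> g) - B) \<ge> 2 * t \<longrightarrow> (F #> g) \<inter> S \<noteq> {})))"
proof -
  define a where "a = card E"
  define q where "q = 64 * a"
  have a: "a \<ge> 1" using E by (auto simp: a_def Suc_le_eq card_gt_0_iff)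
  have q1: "q \<ge> 1" using a by (simp add: q_def)
  obtain \<beta> :: real and t where \<beta>: "0 < \<beta>" "\<beta> < real q" and t: "a \<le> t" and
     param: "4 * real t * real a * 2 ^ (4*t) * ((real a * real q ^ (a-1)) ^ t / \<beta> ^ (a*t - 1)) +
     4 * real t * real a * ((real q ^ a - (real q-1) ^ (a-1)) ^ (2*t) / \<beta> ^ (a*(2*t) - 1)) \<le> real q - \<beta>"
    using local_lemma_parameters[OF a] unfolding q_def by (auto simp: )
  have t1: "t \<ge> 1" using a t by simp
  show ?thesis
  proof (intro exI[of _ t] conjI allI impI)
    show "card E \<le> t" using t a_def by simp
    fix F B Q
    assume asmF: "finite F \<and> F \<subseteq> carrier G \<and> card F = 4 * t \<and>
        (\<forall>\<sigma>\<in>F. \<forall>\<tau>\<in>F. \<sigma> \<noteq> \<tau> \<longrightarrow> (E #> \<sigma>) \<inter> (E #> \<tau>) = {})"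
      and asmQ: "finite Q \<and> Q \<subseteq> carrier G"
    have F: "finite F" "F \<subseteq> carrier G" "card F = 4 * t"
      and Fdisj: "\<And>\<sigma> \<tau>. \<sigma> \<in> F \<Longrightarrow> \<tau> \<in> F \<Longrightarrow> \<sigma> \<noteq> \<tau> \<Longrightarrow> (E #> \<sigma>) \<inter> (E #> \<tau>) = {}"
      and Q: "finite Q" "Q \<subseteq> carrier G"
      using asmF asmQ by auto
    define S0 where "S0 = F <#> Q"
    \<comment> \<open>sparseness is needed for all \<open>g\<close>, but only these finitely many translates can come near \<open>S\<close>\<close>
    define Q' where "Q' = Q \<union> (\<lambda>(\<sigma>, e, s). inv \<sigma> \<otimes> (e \<otimes> s)) ` (F \<times> E \<times> S0)"
    define \<Omega> where "\<Omega> = E <#> (F <#> Q')"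
    define X where "X g = (SOME X. X \<subseteq> {\<sigma>\<in>F. \<sigma> \<otimes> g \<notin> B} \<and> card X = 2 * t)" for g
    define J where "J = Q' \<times> {Y. Y \<subseteq> F \<and> card Y = t} \<times> {True} \<union>
       (\<lambda>g. (g, X g, False)) ` {g\<in>Q'. card ((F #> g) - B) \<ge> 2 * t}"
    define T where "T = (\<lambda>(g, Y, b::bool). \<Union>\<sigma>\<in>Y. E #> (\<sigma> \<otimes> g))"
    define Z where "Z b v = (if b then {h \<in> (E #> v) \<rightarrow>\<^sub>E {..<q}. \<exists>u\<in>E #> v. h u = 0}
       else {h \<in> (E #> v) \<rightarrow>\<^sub>E {..<q}. \<not> (h v = 0 \<and> (\<forall>u\<in>(E #> v) - {v}. h u \<noteq> 0))})" for b v
    define bad where "bad = (\<lambda>(g, Y, b). {f \<in> (\<Union>\<sigma>\<in>Y. E #> (\<sigma> \<otimes> g)) \<rightarrow>\<^sub>E {..<q}.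
       \<forall>\<sigma>\<in>Y. restrict f (E #> (\<sigma> \<otimes> g)) \<in> Z b (\<sigma> \<otimes> g)})"
    have S0: "finite S0" "S0 \<subseteq> carrier G"
      using F Q by (auto simp: S0_def finite_set_mult set_mult_closed)
    have Q': "finite Q'" "Q' \<subseteq> carrier G" "Q \<subseteq> Q'"
      using F(1,2) Q E(1,2) S0 by (auto simp: Q'_def intro!: m_closed inv_closed)
    have X: "X g \<subseteq> {\<sigma>\<in>F. \<sigma> \<otimes> g \<notin> B} \<and> card (X g) = 2 * t" if "g \<in> Q'" "card ((F #> g) - B) \<ge> 2 * t" for g
    proof -
      have "(F #> g) - B = (\<lambda>\<sigma>. \<sigma> \<otimes> g) ` {\<sigma>\<in>F. \<sigma> \<otimes> g \<notin> B}" by (auto simp: r_coset_def)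
      then have "card ((F #> g) - B) \<le> card {\<sigma>\<in>F. \<sigma> \<otimes> g \<notin> B}"
        using F by (simp add: card_image_le)
      then have "2 * t \<le> card {\<sigma>\<in>F. \<sigma> \<otimes> g \<notin> B}" using that by simp
      then have "\<exists>Y. Y \<subseteq> {\<sigma>\<in>F. \<sigma> \<otimes> g \<notin> B} \<and> card Y = 2 * t"
        by (meson obtain_subset_with_card_n)
      then show ?thesis unfolding X_def by (rule someI_ex)
    qed
    have J1: "g \<in> Q' \<and> Y \<subseteq> F \<and> card Y = (if b then t else 2 * t)" if "(g, Y, b) \<in> J" for g Y b
      using that X by (auto simp: J_def)
    have blk_card: "card (E #> (\<sigma> \<otimes> g)) = a" if "\<sigma> \<in> F" "g \<in> carrier G" for \<sigma> g
      using that F E by (auto simp: card_translate a_def)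
    have Tcard: "card (T (g, Y, b)) = a * card Y" if "Y \<subseteq> F" "g \<in> carrier G" for g Y b
    proof -
      have "card (T (g, Y, b)) = (\<Sum>\<sigma>\<in>Y. card (E #> (\<sigma> \<otimes> g)))"
        unfolding T_def prod.case
      proof (rule card_UN_disjoint)
        show "finite Y" using that F finite_subset by blast
        show "\<forall>i\<in>Y. finite (E #> (i \<otimes> g))" using E finite_translate by blast
        show "\<forall>i\<in>Y. \<forall>j\<in>Y. i \<noteq> j \<longrightarrow> (E #> (i \<otimes> g)) \<inter> (E #> (j \<otimes> g)) = {}"
        proof (intro ballI impI)
          fix i j assume ij: "i \<in> Y" "j \<in> Y" "i \<noteq> j"
          then have c: "i \<in> F" "j \<in> F" "i \<in> carrier G" "j \<in> carrier G" using that F by auto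
          show "(E #> (i \<otimes> g)) \<inter> (E #> (j \<otimes> g)) = {}"
          proof (rule ccontr)
            assume "(E #> (i \<otimes> g)) \<inter> (E #> (j \<otimes> g)) \<noteq> {}"
            then obtain e e' where e: "e \<in> E" "e' \<in> E" "e \<otimes> (i \<otimes> g) = e' \<otimes> (j \<otimes> g)"
              by (auto simp: mem_translate)
            have ec: "e \<in> carrier G" "e' \<in> carrier G" using e E by auto
            have "(e \<otimes> i) \<otimes> g = (e' \<otimes> j) \<otimes> g" using e ec c that by (simp add: m_assoc)
            then have "e \<otimes> i = e' \<otimes> j" using ec c that by simp
            then have "e \<otimes> i \<in> (E #> i) \<inter> (E #> j)" using e unfolding Int_iff mem_translate by blast
            then show False using Fdisj[OF c(1,2) ij(3)] by blast
          qed
        qed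
      qed
      also have "\<dots> = (\<Sum>\<sigma>\<in>Y. a)" using that by (intro sum.cong) (auto intro!: blk_card)
      finally show ?thesis by simp
    qed
    have finJ: "finite J"
      unfolding J_def using F Q' by auto
    have T\<Omega>: "T j \<subseteq> \<Omega>" if "j \<in> J" for j
    proof -
      obtain g Y b where j: "j = (g, Y, b)" by (cases j)
      then have "g \<in> Q'" "Y \<subseteq> F" using J1[of g Y b] that by auto
      then show ?thesis unfolding j T_def \<Omega>_def prod.case
        by (auto simp: mem_translate intro!: set_multI)
    qed
    have fin\<Omega>: "finite \<Omega>" using E F Q' by (simp add: \<Omega>_def finite_set_mult)
    define z where "z b = (if b then real a * real q ^ (a-1) else real q ^ a - (real q - 1) ^ (a-1))" for b
    have Zfin: "finite (Z b v)" for b v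
      using finite_translate[OF E(2), of v]
      by (auto simp: Z_def intro!: finite_subset[OF _ finite_PiE[of "E #> v" "\<lambda>_. {..<q}"]])
    have self: "v \<in> E #> v" if "v \<in> carrier G" for v
      using that E by (auto simp: mem_translate intro!: bexI[of _ \<one>])
    have Zcard: "real (card (Z b (\<sigma> \<otimes> g))) \<le> z b" if "\<sigma> \<in> F" "g \<in> carrier G" for b \<sigma> g
    proof (cases b)
      case True
      then show ?thesis
        using card_patterns_with_zero[OF finite_translate[OF E(2)] blk_card[OF that] q1]
        by (simp add: Z_def z_def flip: of_nat_power of_nat_mult)
    next
      case False
      have "\<sigma> \<otimes> g \<in> E #> (\<sigma> \<otimes> g)" using that F self by auto
      from card_patterns_not_isolated_zero[OF finite_translate[OF E(2)] blk_card[OF that] this q1]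
      show ?thesis using False by (simp add: Z_def z_def)
    qed
    have badcard: "real (card (bad (g, Y, b))) \<le> z b ^ card Y" and badfin: "finite (bad (g, Y, b))"
      if "(g, Y, b) \<in> J" for g Y b
    proof -
      have Y: "Y \<subseteq> F" "finite Y" "g \<in> carrier G" using J1[OF that] F Q' finite_subset by auto
      let ?z = "Max ((\<lambda>\<sigma>. card (Z b (\<sigma> \<otimes> g))) ` Y)"
      have "Y \<noteq> {}" using J1[OF that] t1 by (auto split: if_splits)
      have m: "finite (Z b (\<sigma> \<otimes> g)) \<and> card (Z b (\<sigma> \<otimes> g)) \<le> ?z" if "\<sigma> \<in> Y" for \<sigma>
        using Y Zfin that by auto
      show "finite (bad (g, Y, b))" unfolding bad_def prod.case
        using card_product_patterns_le(1)[OF Y(2), of "\<lambda>\<sigma>. Z b (\<sigma> \<otimes> g)" ?z] m by simp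
      have "?z \<in> (\<lambda>\<sigma>. card (Z b (\<sigma> \<otimes> g))) ` Y"
        using Y \<open>Y \<noteq> {}\<close> by (intro Max_in) auto
      then have zz: "real ?z \<le> z b" using Zcard Y by auto
      have "card (bad (g, Y, b)) \<le> ?z ^ card Y" unfolding bad_def prod.case
        using card_product_patterns_le(2)[OF Y(2), of "\<lambda>\<sigma>. Z b (\<sigma> \<otimes> g)" ?z] m by simp
      then have "real (card (bad (g, Y, b))) \<le> real ?z ^ card Y" by (simp flip: of_nat_power)
      also have "\<dots> \<le> z b ^ card Y" using zz by (intro power_mono) auto
      finally show "real (card (bad (g, Y, b))) \<le> z b ^ card Y" .
    qed
    define w where "w b = z b ^ (if b then t else 2 * t) / \<beta> ^ (a * (if b then t else 2 * t) - 1)" for b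
    have wj: "real (card (bad (g, Y, b))) / \<beta> ^ (card (T (g, Y, b)) - 1) \<le> w b" if "(g, Y, b) \<in> J" for g Y b
    proof -
      have Y: "g \<in> carrier G" "Y \<subseteq> F" "card Y = (if b then t else 2 * t)" using J1[OF that] Q' by auto
      show ?thesis using badcard[OF that] \<beta>
        unfolding w_def Tcard[OF Y(2,1)] Y(3) by (intro divide_right_mono) auto
    qed
    have z0: "z b \<ge> 0" for b
    proof (cases b)
      case False
      have "(real q - 1) ^ (a-1) \<le> real q ^ (a-1)" using q1 by (intro power_mono) auto
      also have "\<dots> \<le> real q ^ a" using q1 by (intro power_increasing) auto
      finally show ?thesis using False by (simp add: z_def)
    qed (simp add: z_def)
    have w0: "w b \<ge> 0" for b using z0 \<beta> by (simp add: w_def)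
    have weight: "(\<Sum>j\<in>{j\<in>J. v \<in> T j}. real (card (bad j)) / \<beta> ^ (card (T j) - 1)) \<le> real (card {..<q}) - \<beta>"
      if v: "v \<in> \<Omega>" for v
    proof -
      have "\<Omega> \<subseteq> carrier G" unfolding \<Omega>_def by (intro set_mult_closed E(1) F(2) Q'(2))
      then have vc: "v \<in> carrier G" using v by blast
      \<comment> \<open>the events that involve \<open>v\<close> belong to at most \<open>4 t a\<close> translates\<close>
      define Gv where "Gv = (\<lambda>(e, \<sigma>). inv (e \<otimes> \<sigma>) \<otimes> v) ` (E \<times> F)"
      have cG: "card Gv \<le> a * (4 * t)" "finite Gv"
        using card_image_le[of "E \<times> F" "\<lambda>(e, \<sigma>). inv (e \<otimes> \<sigma>) \<otimes> v"] E F
        by (auto simp: Gv_def a_def card_cartesian_product)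
      have inG: "g \<in> Gv" if gJ: "(g, Y, b) \<in> J" and gT: "v \<in> T (g, Y, b)" for g Y b
      proof -
        obtain \<sigma> e where se: "\<sigma> \<in> Y" "e \<in> E" "v = e \<otimes> (\<sigma> \<otimes> g)"
          using gT by (auto simp: T_def mem_translate)
        then have c: "\<sigma> \<in> F" "\<sigma> \<in> carrier G" "e \<in> carrier G" "g \<in> carrier G"
          using J1[OF gJ] F E Q' by auto
        have "inv (e \<otimes> \<sigma>) \<otimes> v = g"
          unfolding se m_assoc[OF c(3,2,4), symmetric]
          using c by (subst m_assoc[symmetric]) auto
        then show ?thesis unfolding Gv_def using c se by force
      qed
      let ?A = "Gv \<times> {Y. Y \<subseteq> F \<and> card Y = t} \<times> {True}"
      let ?B = "(\<lambda>g. (g, X g, False)) ` Gv"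
      let ?w = "\<lambda>j::'a \<times> 'a set \<times> bool. w (snd (snd j))"
      have finP: "finite {Y. Y \<subseteq> F \<and> card Y = t}" using F by simp
      have "{j\<in>J. v \<in> T j} \<subseteq> ?A \<union> ?B"
      proof
        fix j assume j: "j \<in> {j\<in>J. v \<in> T j}"
        obtain g Y b where jj: "j = (g, Y, b)" by (cases j) auto
        have "g \<in> Gv" using inG[of g Y b] j jj by simp
        then show "j \<in> ?A \<union> ?B" using j jj by (auto simp: J_def)
      qed
      have "(\<Sum>j\<in>{j\<in>J. v \<in> T j}. real (card (bad j)) / \<beta> ^ (card (T j) - 1)) \<le> (\<Sum>j\<in>{j\<in>J. v \<in> T j}. ?w j)"
        using wj by (intro sum_mono) auto
      also have "\<dots> \<le> (\<Sum>j\<in>?A \<union> ?B. ?w j)"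
        using \<open>_ \<subseteq> ?A \<union> ?B\<close> cG finP w0 by (intro sum_mono2) auto
      also have "\<dots> \<le> (\<Sum>j\<in>?A. ?w j) + (\<Sum>j\<in>?B. ?w j)"
        using cG finP w0 sum.union_inter[of ?A ?B ?w] sum_nonneg[of "?A \<inter> ?B" ?w] by auto
      also have "(\<Sum>j\<in>?A. ?w j) = real (card ?A) * w True"
        by (subst sum_constant[symmetric]) (rule sum.cong, auto)
      also have "(\<Sum>j\<in>?B. ?w j) = real (card ?B) * w False"
        by (subst sum_constant[symmetric]) (rule sum.cong, auto)
      also have "real (card ?A) * w True + real (card ?B) * w False
         \<le> (4 * real t * real a * 2 ^ (4*t)) * w True + (4 * real t * real a) * w False"
      proof (intro add_mono mult_right_mono w0)
        have "card {Y. Y \<subseteq> F \<and> card Y = t} \<le> card (Pow F)" using F by (intro card_mono) auto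
        then have "card {Y. Y \<subseteq> F \<and> card Y = t} \<le> 2 ^ (4*t)" using F by (simp add: card_Pow)
        then have "card ?A \<le> (a * (4 * t)) * 2 ^ (4*t)"
          using cG unfolding card_cartesian_product by (auto intro!: mult_le_mono)
        then have "real (card ?A) \<le> real ((a * (4 * t)) * 2 ^ (4*t))" by (simp only: of_nat_le_iff)
        then show "real (card ?A) \<le> 4 * real t * real a * 2 ^ (4*t)" by (simp add: mult_ac)
        have "card ?B \<le> a * (4 * t)" using card_image_le[OF cG(2)] cG(1) le_trans by blast
        then have "real (card ?B) \<le> real (a * (4 * t))" by (simp only: of_nat_le_iff)
        then show "real (card ?B) \<le> 4 * real t * real a" by (simp add: mult_ac)
      qed
      also have "\<dots> \<le> real q - \<beta>" using param by (simp add: w_def z_def)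
      finally show ?thesis by simp
    qed
    have "\<exists>f \<in> \<Omega> \<rightarrow>\<^sub>E {..<q}. \<forall>j\<in>J. restrict f (T j) \<notin> bad j"
    proof (rule counting_local_lemma[OF fin\<Omega> _ finJ T\<Omega> _ _ \<beta>(1) weight])
      show "T j \<noteq> {}" if "j \<in> J" for j
      proof -
        obtain g Y b where j: "j = (g, Y, b)" by (cases j)
        then have "Y \<noteq> {}" using J1[of g Y b] that t1 by (auto split: if_splits)
        then show ?thesis using E by (auto simp: T_def j r_coset_def)
      qed
      show "finite (bad j)" if "j \<in> J" for j
        using badfin that by (cases j) auto
    qed auto
    then obtain f where f: "f \<in> \<Omega> \<rightarrow>\<^sub>E {..<q}" and good: "\<And>j. j \<in> J \<Longrightarrow> restrict f (T j) \<notin> bad j"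
      by blast
    have witness: "\<exists>\<sigma>\<in>Y. restrict f (E #> (\<sigma> \<otimes> g)) \<notin> Z b (\<sigma> \<otimes> g)" if j: "(g, Y, b) \<in> J" for g Y b
    proof (rule ccontr)
      assume "\<not> ?thesis"
      moreover have "restrict (restrict f (T (g, Y, b))) (E #> (\<sigma> \<otimes> g)) = restrict f (E #> (\<sigma> \<otimes> g))" if "\<sigma> \<in> Y" for \<sigma>
        using that by (auto simp: T_def fun_eq_iff restrict_def)
      moreover have "restrict f (T (g, Y, b)) \<in> T (g, Y, b) \<rightarrow>\<^sub>E {..<q}"
        using f T\<Omega>[OF j] by auto
      ultimately have "restrict f (T (g, Y, b)) \<in> bad (g, Y, b)"
        unfolding bad_def by (simp add: T_def)
      then show False using good[OF j] by blast
    qed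
    have blk\<Omega>: "E #> (\<sigma> \<otimes> g) \<subseteq> \<Omega>" if "\<sigma> \<in> F" "g \<in> Q'" for \<sigma> g
      using that unfolding \<Omega>_def by (auto simp: mem_translate intro!: set_multI)
    have restrict_blk: "restrict f (E #> (\<sigma> \<otimes> g)) \<in> (E #> (\<sigma> \<otimes> g)) \<rightarrow>\<^sub>E {..<q}" if "\<sigma> \<in> F" "g \<in> Q'" for \<sigma> g
      using blk\<Omega>[OF that] f by auto
    define S where "S = {v \<in> S0. v \<notin> B \<and> f v = 0 \<and> (\<forall>u\<in>(E #> v) - {v}. f u \<noteq> 0)}"
    show "\<exists>S. finite S \<and> S \<subseteq> carrier G - B \<and>
          (\<forall>s\<in>S. \<forall>s'\<in>S. s \<noteq> s' \<longrightarrow> s' \<notin> E #> s) \<and>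
          (\<forall>g\<in>carrier G. card ((F #> g) \<inter> (E <#> S)) \<le> t) \<and>
          (\<forall>g\<in>Q. card ((F #> g) - B) \<ge> 2 * t \<longrightarrow> (F #> g) \<inter> S \<noteq> {})"
    proof (intro exI[of _ S] conjI ballI impI)
      show "finite S" "S \<subseteq> carrier G - B" using S0 by (auto simp: S_def)
      show "s' \<notin> E #> s" if "s \<in> S" "s' \<in> S" "s \<noteq> s'" for s s' using that unfolding S_def by blast
      show "(F #> g) \<inter> S \<noteq> {}" if g: "g \<in> Q" "card ((F #> g) - B) \<ge> 2 * t" for g
      proof -
        have g': "g \<in> Q'" "g \<in> carrier G" using g Q' by auto
        then have "(g, X g, False) \<in> J" using g by (auto simp: J_def)
        from witness[OF this] obtain \<sigma> where \<sigma>: "\<sigma> \<in> X g" "restrict f (E #> (\<sigma> \<otimes> g)) \<notin> Z False (\<sigma> \<otimes> g)" by blast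
        then have \<sigma>F: "\<sigma> \<in> F" "\<sigma> \<otimes> g \<notin> B" using X g g' by auto
        have sc: "\<sigma> \<otimes> g \<in> E #> (\<sigma> \<otimes> g)" using self \<sigma>F F g' by auto
        have "f (\<sigma> \<otimes> g) = 0 \<and> (\<forall>u\<in>(E #> (\<sigma> \<otimes> g)) - {\<sigma> \<otimes> g}. f u \<noteq> 0)"
          using \<sigma>(2) restrict_blk[OF \<sigma>F(1) g'(1)] sc by (auto simp: Z_def)
        moreover have "\<sigma> \<otimes> g \<in> S0" using \<sigma>F g by (auto simp: S0_def mem_set_mult)
        ultimately have "\<sigma> \<otimes> g \<in> S" using \<sigma>F by (simp add: S_def)
        moreover have "\<sigma> \<otimes> g \<in> F #> g" using \<sigma>F by (auto simp: mem_translate)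
        ultimately show ?thesis by blast
      qed
      show "card ((F #> g) \<inter> (E <#> S)) \<le> t" if g: "g \<in> carrier G" for g
      proof (rule ccontr)
        assume "\<not> ?thesis"
        moreover have "(F #> g) \<inter> (E <#> S) = (\<lambda>\<sigma>. \<sigma> \<otimes> g) ` {\<sigma>\<in>F. \<sigma> \<otimes> g \<in> E <#> S}"
          by (auto simp: r_coset_def)
        moreover have "card ((\<lambda>\<sigma>. \<sigma> \<otimes> g) ` {\<sigma>\<in>F. \<sigma> \<otimes> g \<in> E <#> S}) \<le> card {\<sigma>\<in>F. \<sigma> \<otimes> g \<in> E <#> S}"
          using F by (intro card_image_le) auto
        ultimately have "t \<le> card {\<sigma>\<in>F. \<sigma> \<otimes> g \<in> E <#> S}" by simp
        then obtain Y where Y: "Y \<subseteq> {\<sigma>\<in>F. \<sigma> \<otimes> g \<in> E <#> S}" "card Y = t"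
          by (meson obtain_subset_with_card_n)
        have zero: "\<exists>s\<in>S0. \<exists>e\<in>E. \<sigma> \<otimes> g = e \<otimes> s \<and> f s = 0 \<and> s \<in> E #> (\<sigma> \<otimes> g)" if \<sigma>Y: "\<sigma> \<in> Y" for \<sigma>
        proof -
          have "\<sigma> \<otimes> g \<in> E <#> S" using \<sigma>Y Y by auto
          then obtain e s where es: "e \<in> E" "s \<in> S" "\<sigma> \<otimes> g = e \<otimes> s" by (auto simp: mem_set_mult)
          have c: "e \<in> carrier G" "s \<in> carrier G" using es E S0 by (auto simp: S_def)
          have "s = inv e \<otimes> (\<sigma> \<otimes> g)" unfolding es(3) using c by (simp add: m_assoc[symmetric])
          moreover have "inv e \<in> E" using E(4) es by blast
          ultimately have "s \<in> E #> (\<sigma> \<otimes> g)" by (auto simp: mem_translate)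
          then show ?thesis using es by (auto simp: S_def)
        qed
        have "Y \<noteq> {}" using Y t1 by auto
        then obtain \<sigma> where "\<sigma> \<in> Y" by blast
        with zero[OF this] obtain e s where es: "e \<in> E" "s \<in> S0" "\<sigma> \<otimes> g = e \<otimes> s" by blast
        have \<sigma>: "\<sigma> \<in> F" "\<sigma> \<in> carrier G" using \<open>\<sigma> \<in> Y\<close> Y F by auto
        have "inv \<sigma> \<otimes> (e \<otimes> s) = g" unfolding es(3)[symmetric] using \<sigma> g by (simp add: m_assoc[symmetric])
        then have g': "g \<in> Q'" unfolding Q'_def using \<sigma> es by force
        then have "(g, Y, True) \<in> J" using Y by (auto simp: J_def)
        from witness[OF this] obtain \<tau> where \<tau>: "\<tau> \<in> Y" "restrict f (E #> (\<tau> \<otimes> g)) \<notin> Z True (\<tau> \<otimes> g)" by blast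
        then have "\<tau> \<in> F" using Y by auto
        with \<tau> zero[OF \<tau>(1)] restrict_blk[OF _ g'] show False by (auto simp: Z_def)
      qed
    qed
  qed
qed

text \<open>Points are selected greedily: each selected point excludes at most \<open>card E * card E\<close> others.\<close>

lemma separated_subset:
  assumes E: "E \<subseteq> carrier G" "finite E"
    and F: "F \<subseteq> carrier G" "finite F" "card F \<ge> n * (card E * card E) + n"
  shows "\<exists>F'\<subseteq>F. card F' = n \<and> (\<forall>\<sigma>\<in>F'. \<forall>\<tau>\<in>F'. \<sigma> \<noteq> \<tau> \<longrightarrow> (E #> \<sigma>) \<inter> (E #> \<tau>) = {})"
  using F(3)
proof (induction n)
  case 0
  then show ?case by (intro exI[of _ "{}"]) auto
next
  case (Suc n)
  then obtain F' where F': "F' \<subseteq> F" "card F' = n"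
      "\<forall>\<sigma>\<in>F'. \<forall>\<tau>\<in>F'. \<sigma> \<noteq> \<tau> \<longrightarrow> (E #> \<sigma>) \<inter> (E #> \<tau>) = {}" by auto
  have fin: "finite F'" using F' F finite_subset by blast
  let ?D = "F' \<union> (\<lambda>(e, e', \<sigma>). inv e \<otimes> (e' \<otimes> \<sigma>)) ` (E \<times> E \<times> F')"
  have "card ?D \<le> card F' + card ((\<lambda>(e, e', \<sigma>). inv e \<otimes> (e' \<otimes> \<sigma>)) ` (E \<times> E \<times> F'))" by (rule card_Un_le)
  also have "\<dots> \<le> card F' + card (E \<times> E \<times> F')"
    using E fin by (intro add_left_mono card_image_le) auto
  also have "\<dots> < card F" using Suc.prems F' by (simp add: card_cartesian_product algebra_simps)
  finally have "\<not> F \<subseteq> ?D" using E fin card_mono[of ?D F] by auto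
  then obtain \<sigma> where \<sigma>: "\<sigma> \<in> F" "\<sigma> \<notin> ?D" by blast
  have new: "(E #> \<sigma>) \<inter> (E #> \<tau>) = {}" if "\<tau> \<in> F'" for \<tau>
  proof (rule ccontr)
    assume "\<not> ?thesis"
    then obtain e e' where e: "e \<in> E" "e' \<in> E" "e \<otimes> \<sigma> = e' \<otimes> \<tau>" by (auto simp: mem_translate)
    have c: "e \<in> carrier G" "\<sigma> \<in> carrier G" using e E \<sigma> F by auto
    have "\<sigma> = inv e \<otimes> (e' \<otimes> \<tau>)" unfolding e(3)[symmetric] using c by (simp add: m_assoc[symmetric])
    then show False using \<sigma>(2) e that by force
  qed
  show ?case
  proof (intro exI[of _ "insert \<sigma> F'"] conjI)
    show "card (insert \<sigma> F') = Suc n" using \<sigma> fin F' by auto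
    show "\<forall>\<rho>\<in>insert \<sigma> F'. \<forall>\<tau>\<in>insert \<sigma> F'. \<rho> \<noteq> \<tau> \<longrightarrow> (E #> \<rho>) \<inter> (E #> \<tau>) = {}"
      using new F'(3) by (metis insert_iff inf_commute)
  qed (use \<sigma> F' in auto)
qed

end

section \<open>Levels of patterns\<close>

text \<open>One stage of the construction: the finite domain of the pattern (only the coordinates below
  the index of the stage count), the pattern, the finite set \<open>F\<close> of the introduction, and a
  threshold, for which a quarter of the size of \<open>F\<close> will be taken. Copies of the pattern are
  placed so that their products with the margin are disjoint. The reach bounds how far the placement of copies of lower levels
  can enlarge a set.\<close>

record 'a level =
  window :: "'a set"
  pattern :: "'a \<Rightarrow> nat \<Rightarrow> nat"
  shifts :: "'a set"
  threshold :: nat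
  margin :: "'a set"
  reach :: "'a set"

context group
begin

lemma translateI: "a \<in> A \<Longrightarrow> a \<otimes> g \<in> A #> g"
  by (auto simp: mem_translate)

lemma set_mult_Un_right: "A <#> (B \<union> C) = (A <#> B) \<union> (A <#> C)"
  by (auto simp: set_mult_def)

lemma subset_set_mult_one: "\<one> \<in> A \<Longrightarrow> B \<subseteq> carrier G \<Longrightarrow> B \<subseteq> A <#> B"
  by (force simp: mem_set_mult)

lemma translate_eq_set_mult: "A #> g = A <#> {g}"
  by (simp add: r_coset_eq_set_mult)

lemma inv_image_closed: "A \<subseteq> carrier G \<Longrightarrow> m_inv G ` A \<subseteq> carrier G"
  by auto

text \<open>A new vertex has at most two neighbours, so one of the three colours is free for it.\<close>

lemma extend_three_colouring:
  assumes W: "finite W" "W \<subseteq> carrier G" and g: "g \<in> carrier G" "g \<noteq> \<one>"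
    and P: "P \<subseteq> W"
    and c: "\<And>u. u \<in> P \<Longrightarrow> c u < (3::nat)" "\<And>u. u \<in> P \<Longrightarrow> g \<otimes> u \<in> P \<Longrightarrow> c u \<noteq> c (g \<otimes> u)"
  shows "\<exists>c'. (\<forall>u\<in>P. c' u = c u) \<and> (\<forall>u\<in>W. c' u < 3 \<and> (g \<otimes> u \<in> W \<longrightarrow> c' u \<noteq> c' (g \<otimes> u)))"
proof -
  have "\<exists>c'. (\<forall>u\<in>P. c' u = c u) \<and> (\<forall>u\<in>P \<union> D. c' u < 3 \<and> (g \<otimes> u \<in> P \<union> D \<longrightarrow> c' u \<noteq> c' (g \<otimes> u)))"
    if "finite D" "D \<subseteq> W - P" for D
    using that
  proof (induction D rule: finite_induct)
    case empty
    show ?case using c by (intro exI[of _ c]) auto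
  next
    case (insert u D)
    then obtain c' where c': "\<And>v. v \<in> P \<Longrightarrow> c' v = c v" "\<And>v. v \<in> P \<union> D \<Longrightarrow> c' v < 3"
        "\<And>v. v \<in> P \<union> D \<Longrightarrow> g \<otimes> v \<in> P \<union> D \<Longrightarrow> c' v \<noteq> c' (g \<otimes> v)" by auto
    have "card {c' (g \<otimes> u), c' (inv g \<otimes> u)} < card {..<3::nat}"
      by (auto simp: card_insert_if)
    then have "\<not> {..<3::nat} \<subseteq> {c' (g \<otimes> u), c' (inv g \<otimes> u)}"
      using card_mono[of "{c' (g \<otimes> u), c' (inv g \<otimes> u)}" "{..<3::nat}"] by auto
    then obtain x where x: "x < 3" "x \<noteq> c' (g \<otimes> u)" "x \<noteq> c' (inv g \<otimes> u)" by auto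
    have u: "u \<in> carrier G" "u \<notin> P" "u \<notin> D" using insert W by auto
    have gu: "g \<otimes> u \<noteq> u" using g u by simp
    have pre: "v = inv g \<otimes> u" if "g \<otimes> v = u" "v \<in> carrier G" for v
      using that g by (simp add: m_assoc[symmetric] flip: that(1))
    have PD: "P \<union> D \<subseteq> carrier G" using insert.prems P W by auto
    show ?case
    proof (intro exI[of _ "c'(u := x)"] conjI ballI impI)
      show "(c'(u := x)) v = c v" if "v \<in> P" for v using that c' u by auto
      show "(c'(u := x)) v < 3" if "v \<in> P \<union> insert u D" for v using that c' x by auto
      show "(c'(u := x)) v \<noteq> (c'(u := x)) (g \<otimes> v)"
        if v: "v \<in> P \<union> insert u D" "g \<otimes> v \<in> P \<union> insert u D" for v
      proof (cases "v = u")
        case True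
        then show ?thesis using gu x by simp
      next
        case False
        then have vPD: "v \<in> P \<union> D" "v \<in> carrier G" using v PD by auto
        show ?thesis
        proof (cases "g \<otimes> v = u")
          case True
          then show ?thesis using pre[OF True vPD(2)] x False by simp
        next
          case False
          then show ?thesis using c'(3)[of v] v vPD \<open>v \<noteq> u\<close> by auto
        qed
      qed
    qed
  qed
  from this[of "W - P"] show ?thesis using W P by (auto simp: Un_absorb1)
qed

text \<open>A point \<open>s\<close> lies in \<open>conflict d <#> W\<close> iff the products of the margin with the copy of the
  window of \<open>d\<close> at \<open>s\<close> and with \<open>W\<close> intersect, so that the copy cannot be placed there.\<close>

definition conflict :: "'a level \<Rightarrow> 'a set" where
  "conflict d = (m_inv G ` window d) <#> ((m_inv G ` margin d) <#> margin d)"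

text \<open>All points \<open>s\<close> for which some translate of \<open>shifts d\<close> contains \<open>s\<close> and meets the conflict zone of
  the reach of \<open>W\<close> lie in \<open>near d <#> W\<close>; copies placed elsewhere can be dropped.\<close>

definition near :: "'a level \<Rightarrow> 'a set" where
  "near d = shifts d <#> ((m_inv G ` shifts d) <#> (conflict d <#> reach d))"

definition occurs :: "nat \<Rightarrow> 'a level \<Rightarrow> 'a set \<Rightarrow> ('a \<Rightarrow> nat \<Rightarrow> nat) \<Rightarrow> 'a \<Rightarrow> bool" where
  "occurs i d W q v \<longleftrightarrow> (\<forall>w\<in>window d. w \<otimes> v \<in> W \<and> (\<forall>l<i. q (w \<otimes> v) l = pattern d w l))"

text \<open>The invariant of the construction: translates that are more than half blocked by the window \<open>W\<close> are
  hit by an occurrence of the pattern of \<open>d\<close> inside \<open>W\<close>.\<close>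

definition robust :: "nat \<Rightarrow> 'a level \<Rightarrow> 'a set \<Rightarrow> ('a \<Rightarrow> nat \<Rightarrow> nat) \<Rightarrow> bool" where
  "robust i d W q \<longleftrightarrow> (\<forall>g\<in>carrier G. 2 * threshold d < card ((shifts d #> g) \<inter> (conflict d <#> W)) \<longrightarrow>
     (\<exists>\<sigma>\<in>shifts d. occurs i d W q (\<sigma> \<otimes> g)))"

definition proper :: "(nat \<Rightarrow> 'a) \<Rightarrow> nat \<Rightarrow> 'a set \<Rightarrow> ('a \<Rightarrow> nat \<Rightarrow> nat) \<Rightarrow> bool" where
  "proper \<gamma> n W q \<longleftrightarrow> (\<forall>u\<in>W. \<forall>l<n. q u l < 3 \<and> (\<gamma> l \<otimes> u \<in> W \<longrightarrow> q u l \<noteq> q (\<gamma> l \<otimes> u) l))"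

text \<open>What \<open>sparse_hitting_set\<close> provides for the data of a level. The neighbourhood in the sparseness
  condition includes the reach, because lower levels are filled in around the copies
  afterwards.\<close>

definition hitting :: "'a level \<Rightarrow> bool" where
  "hitting d \<longleftrightarrow> (\<forall>B Q. finite Q \<and> Q \<subseteq> carrier G \<longrightarrow> (\<exists>S. finite S \<and> S \<subseteq> carrier G - B \<and>
     (\<forall>s\<in>S. \<forall>s'\<in>S. s \<noteq> s' \<longrightarrow> (margin d <#> (window d #> s)) \<inter> (margin d <#> (window d #> s')) = {}) \<and>
     (\<forall>g\<in>carrier G. card ((shifts d #> g) \<inter> (conflict d <#> (reach d <#> (window d <#> S)))) \<le> 2 * threshold d) \<and>
     (\<forall>g\<in>Q. card ((shifts d #> g) \<inter> B) \<le> 2 * threshold d \<longrightarrow> (shifts d #> g) \<inter> S \<noteq> {})))"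

lemma hittingE:
  assumes "hitting d" "finite Q" "Q \<subseteq> carrier G"
  obtains S where "finite S" "S \<subseteq> carrier G - B"
    "\<And>s s'. s \<in> S \<Longrightarrow> s' \<in> S \<Longrightarrow> s \<noteq> s' \<Longrightarrow>
      (margin d <#> (window d #> s)) \<inter> (margin d <#> (window d #> s')) = {}"
    "\<And>g. g \<in> carrier G \<Longrightarrow>
      card ((shifts d #> g) \<inter> (conflict d <#> (reach d <#> (window d <#> S)))) \<le> 2 * threshold d"
    "\<And>g. g \<in> Q \<Longrightarrow> card ((shifts d #> g) \<inter> B) \<le> 2 * threshold d \<Longrightarrow> (shifts d #> g) \<inter> S \<noteq> {}"
proof -
  from assms(1)[unfolded hitting_def, THEN spec, THEN spec, THEN mp, OF conjI[OF assms(2,3)], of B]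
  obtain S where S: "finite S" "S \<subseteq> carrier G - B"
    and S3: "\<forall>s\<in>S. \<forall>s'\<in>S. s \<noteq> s' \<longrightarrow>
      (margin d <#> (window d #> s)) \<inter> (margin d <#> (window d #> s')) = {}"
    and S4: "\<forall>g\<in>carrier G. card ((shifts d #> g) \<inter> (conflict d <#> (reach d <#> (window d <#> S)))) \<le> 2 * threshold d"
    and S5: "\<forall>g\<in>Q. card ((shifts d #> g) \<inter> B) \<le> 2 * threshold d \<longrightarrow> (shifts d #> g) \<inter> S \<noteq> {}"
    by (elim exE conjE) metis
  show thesis by (rule that[OF S]) (simp_all add: S3 S4 S5)
qed

text \<open>The requirements on a level \<open>d\<close> above the levels \<open>f i\<close> with \<open>i < k\<close>. The margin contains all
  quotients of points of \<open>conflict (f i)\<close> and \<open>shifts (f i)\<close>, so that no translate of a lower set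
  \<open>shifts (f i)\<close> is in conflict with two copies whose products with the margin are disjoint; it also
  contains \<open>\<gamma> i\<close>, so that different copies impose no colouring condition on each other. By the last condition the window of \<open>d\<close> is too small
  to block more than half of a translate of \<open>shifts d\<close>, so the pattern of \<open>d\<close> is trivially robust
  for \<open>d\<close> itself, and it can serve as the start for the next pattern.\<close>

definition level_ok :: "(nat \<Rightarrow> 'a) \<Rightarrow> (nat \<Rightarrow> 'a level) \<Rightarrow> nat \<Rightarrow> 'a level \<Rightarrow> bool" where
  "level_ok \<gamma> f k d \<longleftrightarrow>
     (finite (window d) \<and> window d \<subseteq> carrier G \<and> \<one> \<in> window d) \<and>
     (finite (shifts d) \<and> shifts d \<subseteq> carrier G \<and> 2 * threshold d < card (shifts d)) \<and>
     (finite (margin d) \<and> margin d \<subseteq> carrier G \<and> \<one> \<in> margin d) \<and>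
     (finite (reach d) \<and> reach d \<subseteq> carrier G \<and> \<one> \<in> reach d) \<and>
     (\<forall>i<k. \<gamma> i \<in> margin d \<and> (m_inv G ` shifts (f i)) <#> conflict (f i) \<subseteq> margin d \<and>
        reach (f i) <#> insert \<one> (window (f i) <#> near (f i)) \<subseteq> reach d \<and>
        robust i (f i) (window d) (pattern d) \<and>
        (Suc i = k \<longrightarrow> window (f i) \<subseteq> window d \<and> \<gamma> i \<in> window d \<and>
           (\<forall>w\<in>window (f i). \<forall>l<i. pattern d w l = pattern (f i) w l))) \<and>
     proper \<gamma> k (window d) (pattern d) \<and>
     hitting d \<and> card (conflict d <#> window d) \<le> 2 * threshold d"

end

section \<open>Extending a tower of levels\<close>

locale tower = group G for G :: "('a, 'm) monoid_scheme" (structure) +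
  fixes \<gamma> :: "nat \<Rightarrow> 'a" and f :: "nat \<Rightarrow> 'a level" and k :: nat
  assumes \<gamma>: "\<And>l. \<gamma> l \<in> carrier G" "\<And>l. \<gamma> l \<noteq> \<one>"
    and levels: "\<And>i. i \<le> k \<Longrightarrow> level_ok \<gamma> f i (f i)"
begin

abbreviation "V i \<equiv> window (f i)"
abbreviation "p i \<equiv> pattern (f i)"
abbreviation "F i \<equiv> shifts (f i)"
abbreviation "t i \<equiv> threshold (f i)"
abbreviation "M i \<equiv> margin (f i)"
abbreviation "K i \<equiv> reach (f i)"
abbreviation "L i \<equiv> conflict (f i)"
abbreviation "N i \<equiv> near (f i)"

lemma level_sets:
  assumes "i \<le> k"
  shows "finite (V i)" "V i \<subseteq> carrier G" "\<one> \<in> V i"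
    "finite (F i)" "F i \<subseteq> carrier G"
    "finite (M i)" "M i \<subseteq> carrier G" "\<one> \<in> M i"
    "finite (K i)" "K i \<subseteq> carrier G" "\<one> \<in> K i"
    "finite (L i)" "L i \<subseteq> carrier G" "\<one> \<in> L i"
    "finite (N i)" "N i \<subseteq> carrier G"
proof -
  show 1: "finite (V i)" "V i \<subseteq> carrier G" "\<one> \<in> V i"
    "finite (F i)" "F i \<subseteq> carrier G"
    "finite (M i)" "M i \<subseteq> carrier G" "\<one> \<in> M i"
    "finite (K i)" "K i \<subseteq> carrier G" "\<one> \<in> K i"
    using levels[OF assms] by (simp_all add: level_ok_def)
  show 2: "finite (L i)" "L i \<subseteq> carrier G"
    unfolding conflict_def
    by (intro finite_set_mult set_mult_closed inv_image_closed finite_imageI 1)+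
  have "inv \<one> \<otimes> (inv \<one> \<otimes> \<one>) \<in> L i"
    unfolding conflict_def by (intro set_multI imageI 1)
  then show "\<one> \<in> L i" by simp
  show "finite (N i)" "N i \<subseteq> carrier G"
    unfolding near_def
    by (intro finite_set_mult set_mult_closed inv_image_closed finite_imageI 1 2)+
qed

lemma level_below:
  assumes "j \<le> k" "i < j"
  shows "\<gamma> i \<in> M j" "(m_inv G ` F i) <#> L i \<subseteq> M j"
    "K i <#> insert \<one> (V i <#> N i) \<subseteq> K j" "robust i (f i) (V j) (p j)"
  using levels[OF assms(1)] assms(2) by (simp_all add: level_ok_def)

text \<open>The set \<open>T l\<close> holds the positions of the copies of level \<open>l\<close>. They are chosen from level \<open>k\<close> downwards,
  so the choice at level \<open>i\<close> is made in view of \<open>occupied T (Suc i)\<close>, which includes the top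
  window itself as a copy at \<open>1\<close>. The new point \<open>\<gamma> k\<close> belongs to the area to be controlled, but it
  does not stop copies from being placed over it.\<close>

definition occupied :: "(nat \<Rightarrow> 'a set) \<Rightarrow> nat \<Rightarrow> 'a set" where
  "occupied T i = V k \<union> (\<Union>l\<in>{i..k}. V l <#> T l)"

definition area :: "(nat \<Rightarrow> 'a set) \<Rightarrow> nat \<Rightarrow> 'a set" where
  "area T i = insert (\<gamma> k) (occupied T i)"

text \<open>The conditions on the positions of level \<open>i\<close>, in terms of those of higher levels. The last one
  concerns only translates that come near the area; this is why finitely many positions suffice.\<close>

definition placed :: "(nat \<Rightarrow> 'a set) \<Rightarrow> nat \<Rightarrow> bool" where
  "placed T i \<longleftrightarrow> finite (T i) \<and> T i \<subseteq> carrier G \<and> T i \<subseteq> N i <#> area T (Suc i) \<and>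
     (\<forall>s\<in>T i. (M i <#> (V i #> s)) \<inter> (M i <#> occupied T (Suc i)) = {}) \<and>
     (\<forall>s\<in>T i. \<forall>s'\<in>T i. s \<noteq> s' \<longrightarrow> (M i <#> (V i #> s)) \<inter> (M i <#> (V i #> s')) = {}) \<and>
     (\<forall>g\<in>carrier G. card ((F i #> g) \<inter> (L i <#> (K i <#> (V i <#> T i)))) \<le> 2 * t i) \<and>
     (\<forall>g\<in>carrier G. (F i #> g) \<inter> (L i <#> (K i <#> area T (Suc i))) \<noteq> {} \<longrightarrow>
        card ((F i #> g) \<inter> (L i <#> occupied T (Suc i))) \<le> 2 * t i \<longrightarrow> (F i #> g) \<inter> T i \<noteq> {})"

lemma occupied_cong: "(\<And>l. i \<le> l \<Longrightarrow> T l = T' l) \<Longrightarrow> occupied T i = occupied T' i"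
  by (simp add: occupied_def)

lemma placed_cong:
  assumes "\<And>l. i \<le> l \<Longrightarrow> T l = T' l"
  shows "placed T i = placed T' i"
proof -
  have "occupied T (Suc i) = occupied T' (Suc i)" using assms by (intro occupied_cong) auto
  then show ?thesis using assms[of i] by (simp add: placed_def area_def)
qed

lemma occupied_finite_closed:
  assumes "\<And>l. i \<le> l \<Longrightarrow> l \<le> k \<Longrightarrow> placed T l"
  shows "finite (occupied T i)" "occupied T i \<subseteq> carrier G"
proof -
  have Tl: "finite (T l)" "T l \<subseteq> carrier G" if "i \<le> l" "l \<le> k" for l
    using assms[OF that] by (auto simp: placed_def)
  show "finite (occupied T i)" unfolding occupied_def
    using Tl level_sets by (auto intro!: finite_set_mult)
  have "V l <#> T l \<subseteq> carrier G" if "l \<in> {i..k}" for l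
    using that Tl level_sets by (intro set_mult_closed) auto
  then show "occupied T i \<subseteq> carrier G" unfolding occupied_def
    using level_sets(2)[of k] by blast
qed

lemma area_finite: "(\<And>l. l \<le> k \<Longrightarrow> placed T l) \<Longrightarrow> finite (area T i)"
  using occupied_finite_closed(1) by (simp add: area_def)

lemma area_closed: "(\<And>l. l \<le> k \<Longrightarrow> placed T l) \<Longrightarrow> area T i \<subseteq> carrier G"
  using occupied_finite_closed(2)[of i T] \<gamma> by (simp add: area_def)

text \<open>The hitting set of level \<open>i\<close> that avoids everything in conflict with the higher copies can be cut down
  to the part near the area: a translate that comes near the area and contains a position
  has this position near the area.\<close>

lemma place_level:
  assumes i: "i \<le> k" and T: "\<And>l. i < l \<Longrightarrow> l \<le> k \<Longrightarrow> placed T l"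
  shows "\<exists>S. placed (T(i := S)) i"
proof -
  let ?U = "occupied T (Suc i)"
  let ?A = "area T (Suc i)"
  have U: "finite ?U" "?U \<subseteq> carrier G"
    using occupied_finite_closed[of "Suc i" T] T by auto
  have A: "finite ?A" "?A \<subseteq> carrier G" using U \<gamma> by (auto simp: area_def)
  note ls = level_sets[OF i]
  let ?Q = "(m_inv G ` F i) <#> (L i <#> (K i <#> ?A))"
  have Q: "finite ?Q" "?Q \<subseteq> carrier G"
    by (intro finite_set_mult set_mult_closed inv_image_closed finite_imageI ls A)+
  have "hitting (f i)" using levels[OF i] by (simp add: level_ok_def)
  then obtain S where S: "finite S" "S \<subseteq> carrier G - (L i <#> ?U)"
     "\<And>s s'. s \<in> S \<Longrightarrow> s' \<in> S \<Longrightarrow> s \<noteq> s' \<Longrightarrow> (M i <#> (V i #> s)) \<inter> (M i <#> (V i #> s')) = {}"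
     "\<And>g. g \<in> carrier G \<Longrightarrow> card ((F i #> g) \<inter> (L i <#> (K i <#> (V i <#> S)))) \<le> 2 * t i"
     "\<And>g. g \<in> ?Q \<Longrightarrow> card ((F i #> g) \<inter> (L i <#> ?U)) \<le> 2 * t i \<Longrightarrow> (F i #> g) \<inter> S \<noteq> {}"
    by (rule hittingE[OF _ Q, of "f i" "L i <#> ?U"]) blast
  define S' where "S' = S \<inter> (N i <#> ?A)"
  let ?T = "T(i := S')"
  have occ: "occupied ?T (Suc i) = ?U" by (rule occupied_cong) auto
  have ar: "area ?T (Suc i) = ?A" by (simp add: area_def occ)
  have "placed ?T i"
    unfolding placed_def occ ar fun_upd_same
  proof (intro conjI ballI impI)
    show "finite S'" "S' \<subseteq> carrier G" "S' \<subseteq> N i <#> ?A" using S by (auto simp: S'_def)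
    show "(M i <#> (V i #> s)) \<inter> (M i <#> (V i #> s')) = {}" if "s \<in> S'" "s' \<in> S'" "s \<noteq> s'" for s s'
      using S(3)[of s s'] that by (simp add: S'_def)
    show "(M i <#> (V i #> s)) \<inter> (M i <#> ?U) = {}" if "s \<in> S'" for s
    proof (rule ccontr)
      assume "\<not> ?thesis"
      then obtain m v m' u where *: "m \<in> M i" "v \<in> V i" "m' \<in> M i" "u \<in> ?U" "m \<otimes> (v \<otimes> s) = m' \<otimes> u"
        by (auto simp: mem_set_mult mem_translate)
      have c: "m \<in> carrier G" "v \<in> carrier G" "m' \<in> carrier G" "u \<in> carrier G" "s \<in> carrier G"
        using * ls U that S by (auto simp: S'_def)
      have "(inv v \<otimes> (inv m \<otimes> m')) \<otimes> u = inv v \<otimes> (inv m \<otimes> (m' \<otimes> u))"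
        using c by (simp add: m_assoc)
      also have "\<dots> = s" unfolding *(5)[symmetric] using c
        by (metis inv_closed l_inv l_one m_assoc m_closed)
      finally have "s = (inv v \<otimes> (inv m \<otimes> m')) \<otimes> u" by simp
      moreover have "inv v \<otimes> (inv m \<otimes> m') \<in> L i"
        unfolding conflict_def by (intro set_multI imageI *)
      ultimately have "s \<in> L i <#> ?U" using * by (auto intro: set_multI)
      then show False using that S by (auto simp: S'_def)
    qed
    show "card ((F i #> g) \<inter> (L i <#> (K i <#> (V i <#> S')))) \<le> 2 * t i" if g: "g \<in> carrier G" for g
    proof -
      have "(F i #> g) \<inter> (L i <#> (K i <#> (V i <#> S'))) \<subseteq> (F i #> g) \<inter> (L i <#> (K i <#> (V i <#> S)))"
        by (intro Int_mono mono_set_mult subset_refl) (simp add: S'_def)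
      then have "card ((F i #> g) \<inter> (L i <#> (K i <#> (V i <#> S')))) \<le> card ((F i #> g) \<inter> (L i <#> (K i <#> (V i <#> S))))"
        using finite_translate[OF ls(4)] by (intro card_mono) auto
      with S(4)[OF g] show ?thesis by linarith
    qed
    show "(F i #> g) \<inter> S' \<noteq> {}"
      if g: "g \<in> carrier G" "(F i #> g) \<inter> (L i <#> (K i <#> ?A)) \<noteq> {}"
        "card ((F i #> g) \<inter> (L i <#> ?U)) \<le> 2 * t i" for g
    proof -
      from g(2) obtain x where "x \<in> F i #> g" and xL: "x \<in> L i <#> (K i <#> ?A)" by blast
      then obtain \<sigma> where \<sigma>: "\<sigma> \<in> F i" "\<sigma> \<otimes> g = x" by (auto simp: mem_translate)
      note x = \<sigma>(1) xL \<sigma>(2)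
      have \<sigma>c: "\<sigma> \<in> carrier G" using x ls by auto
      have g': "g = inv \<sigma> \<otimes> x" unfolding x(3)[symmetric] using \<sigma>c g by (simp add: m_assoc[symmetric])
      have "g \<in> ?Q" unfolding g' using x by (intro set_multI imageI)
      from S(5)[OF this g(3)] obtain s where s: "s \<in> S" "s \<in> F i #> g" by blast
      then obtain \<tau> where \<tau>: "\<tau> \<in> F i" "s = \<tau> \<otimes> g" by (auto simp: mem_translate)
      have "s \<in> F i <#> ?Q" unfolding \<tau>(2) by (intro set_multI \<tau>(1) \<open>g \<in> ?Q\<close>)
      also have "F i <#> ?Q = N i <#> ?A"
        unfolding near_def using ls A
        by (simp add: set_mult_assoc set_mult_closed inv_image_closed)
      finally show ?thesis using s by (auto simp: S'_def)
    qed
  qed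
  then show ?thesis by blast
qed

lemma ex_placement: "\<exists>T. \<forall>i\<le>k. placed T i"
proof -
  have "\<exists>T. \<forall>i. Suc k - m \<le> i \<and> i \<le> k \<longrightarrow> placed T i" if "m \<le> Suc k" for m
    using that
  proof (induction m)
    case 0
    then show ?case by auto
  next
    case (Suc m)
    then obtain T where T: "\<And>i. Suc k - m \<le> i \<Longrightarrow> i \<le> k \<Longrightarrow> placed T i" by auto
    let ?i = "k - m"
    have i: "?i \<le> k" "Suc ?i = Suc k - m" using Suc.prems by auto
    obtain S where S: "placed (T(?i := S)) ?i"
      using place_level[OF i(1), of T] T i by (metis Suc_leI)
    have "placed (T(?i := S)) j" if "Suc k - Suc m \<le> j" "j \<le> k" for j
    proof (cases "j = ?i")
      case False
      then have "?i < j" using that by simp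
      then show ?thesis using placed_cong[of j "T(?i := S)" T] T[of j] i that by auto
    qed (use S in simp)
    then show ?case by blast
  qed
  from this[of "Suc k"] show ?thesis by auto
qed

text \<open>The copies that make up \<open>occupied T i\<close>: the top window is the copy of level \<open>k\<close> at \<open>1\<close>, whatever \<open>i\<close> is.\<close>

definition patches :: "(nat \<Rightarrow> 'a set) \<Rightarrow> nat \<Rightarrow> (nat \<times> 'a) set" where
  "patches T i = insert (k, \<one>) (Sigma {i..k} T)"

lemma occupied_eq_patches: "occupied T i = (\<Union>(l, s)\<in>patches T i. V l #> s)"
proof -
  have "V k #> \<one> = V k" using level_sets(2)[of k] by simp
  moreover have "V l <#> T l = (\<Union>s\<in>T l. V l #> s)" for l
    unfolding set_mult_def r_coset_def by blast
  ultimately show ?thesis unfolding occupied_def patches_def by auto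
qed

text \<open>Each level enlarges the area by a bounded amount, and the reach accumulates these bounds.\<close>

lemma area_subset_reach:
  assumes T: "\<And>l. l \<le> k \<Longrightarrow> placed T l" and i: "i \<le> k"
  shows "area T 0 \<subseteq> K i <#> area T i"
  using i
proof (induction i)
  case 0
  have "area T 0 \<subseteq> carrier G" using area_closed[OF T] by simp
  then show ?case using subset_set_mult_one level_sets(11)[of 0] by simp
next
  case (Suc i)
  then have i: "i < k" "i \<le> k" by auto
  let ?A = "area T (Suc i)"
  note ls = level_sets[OF i(2)]
  have A: "?A \<subseteq> carrier G" using area_closed[OF T] by simp
  have "occupied T i = occupied T (Suc i) \<union> (V i <#> T i)"
  proof -
    have "{i..k} = insert i {Suc i..k}" using i by auto
    then show ?thesis by (auto simp: occupied_def)
  qed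
  then have "area T i = ?A \<union> (V i <#> T i)" by (auto simp: area_def)
  also have "T i \<subseteq> N i <#> ?A" using T[OF i(2)] by (simp add: placed_def)
  then have "V i <#> T i \<subseteq> V i <#> (N i <#> ?A)" by (intro mono_set_mult) auto
  also have "V i <#> (N i <#> ?A) = (V i <#> N i) <#> ?A" using ls A by (simp add: set_mult_assoc)
  also have "?A \<union> \<dots> \<subseteq> insert \<one> (V i <#> N i) <#> ?A"
    using subset_set_mult_one[of "insert \<one> (V i <#> N i)" ?A] A
      mono_set_mult[of "V i <#> N i" "insert \<one> (V i <#> N i)" ?A ?A] by blast
  finally have "area T i \<subseteq> insert \<one> (V i <#> N i) <#> ?A" by blast
  then have "K i <#> area T i \<subseteq> K i <#> (insert \<one> (V i <#> N i) <#> ?A)"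
    by (intro mono_set_mult) auto
  also have "\<dots> = (K i <#> insert \<one> (V i <#> N i)) <#> ?A"
    using ls A set_mult_closed[OF ls(2,16)] by (subst set_mult_assoc) auto
  also have "\<dots> \<subseteq> K (Suc i) <#> ?A"
    using level_below(3)[of "Suc i" i] Suc.prems by (intro mono_set_mult) auto
  finally show ?case using Suc.IH i by blast
qed

lemma patches_disjoint:
  assumes T: "\<And>l. l \<le> k \<Longrightarrow> placed T l"
    and P: "(l, s) \<in> patches T 0" "(l', s') \<in> patches T 0" "(l, s) \<noteq> (l', s')" "l \<le> l'"
  shows "(M l <#> (V l #> s)) \<inter> (M l <#> (V l' #> s')) = {}"
proof -
  have lk: "l \<le> k" "l' \<le> k" using P by (auto simp: patches_def)
  have in_occ: "V j #> r \<subseteq> occupied T (Suc i)" if "(j, r) \<in> patches T (Suc i)" for i j r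
    unfolding occupied_eq_patches using that by blast
  have key: "(M i <#> (V i #> r)) \<inter> (M i <#> (V j #> r')) = {}"
    if "i \<le> k" "r \<in> T i" "(j, r') \<in> patches T (Suc i)" for i j r r'
  proof -
    have "(M i <#> (V i #> r)) \<inter> (M i <#> occupied T (Suc i)) = {}"
      using T[OF that(1)] that(2) by (simp add: placed_def)
    moreover have "M i <#> (V j #> r') \<subseteq> M i <#> occupied T (Suc i)"
      by (intro mono_set_mult subset_refl in_occ that)
    ultimately show ?thesis by blast
  qed
  show ?thesis
  proof (cases "s \<in> T l")
    case True
    show ?thesis
    proof (cases "(l', s') \<in> patches T (Suc l)")
      case True
      then show ?thesis using key[OF lk(1) \<open>s \<in> T l\<close>] by blast
    next
      case False
      then have "s' \<in> T l'" "\<not> Suc l \<le> l'" using P lk by (auto simp: patches_def)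
      moreover from this have "l' = l" using P(4) by simp
      ultimately have "l' = l" "s' \<in> T l" by simp_all
      moreover from this have "s \<noteq> s'" using P(3) by simp
      moreover have "\<forall>s\<in>T l. \<forall>s'\<in>T l. s \<noteq> s' \<longrightarrow> (M l <#> (V l #> s)) \<inter> (M l <#> (V l #> s')) = {}"
        using T[OF lk(1)] by (simp add: placed_def)
      ultimately show ?thesis using True by simp
    qed
  next
    case False
    then have l: "l = k" "s = \<one>" using P by (auto simp: patches_def)
    then have l': "l' = k" using P lk by simp
    then have "s' \<in> T k" using P l by (auto simp: patches_def)
    from key[OF _ this, of k \<one>] show ?thesis unfolding l l' by (auto simp: patches_def)
  qed
qed

text \<open>The copies are disjoint, hence define a partial colouring in each coordinate \<open>l\<close> (a copy of level \<open>j\<close>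
  matters only if \<open>l < j\<close>). It is proper because \<open>\<gamma> l\<close> belongs to the margins and hence
  never joins two different copies. The greedy extension fills the rest of the area.\<close>

lemma ex_filling:
  assumes T: "\<And>l. l \<le> k \<Longrightarrow> placed T l"
  shows "\<exists>q. proper \<gamma> (Suc k) (area T 0) q \<and>
    (\<forall>(j, s)\<in>patches T 0. \<forall>w\<in>V j. \<forall>l<j. q (w \<otimes> s) l = p j w l)"
proof -
  have Tc: "s \<in> carrier G" "j \<le> k" if "(j, s) \<in> patches T 0" for j s
  proof -
    show "j \<le> k" using that by (auto simp: patches_def)
    then have "T j \<subseteq> carrier G" using T by (simp add: placed_def)
    then show "s \<in> carrier G" using that by (auto simp: patches_def)
  qed
  have "\<exists>c. (\<forall>(j, s)\<in>patches T 0. \<forall>w\<in>V j. l < j \<longrightarrow> c (w \<otimes> s) = p j w l) \<and>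
      (\<forall>u\<in>area T 0. c u < 3 \<and> (\<gamma> l \<otimes> u \<in> area T 0 \<longrightarrow> c u \<noteq> c (\<gamma> l \<otimes> u)))" for l
  proof -
    define P where "P = (\<Union>(j, s)\<in>{(j, s)\<in>patches T 0. l < j}. V j #> s)"
    define c where "c u = (SOME x. \<exists>j s w. (j, s) \<in> patches T 0 \<and> l < j \<and> w \<in> V j \<and> u = w \<otimes> s \<and> x = p j w l)" for u
    have same: "j = j' \<and> s = s'"
      if "(j, s) \<in> patches T 0" "(j', s') \<in> patches T 0" "j \<le> j'" "m \<in> M j" "m' \<in> M j"
        "w \<in> V j" "w' \<in> V j'" "m \<otimes> (w \<otimes> s) = m' \<otimes> (w' \<otimes> s')" for j s j' s' m m' w w'
    proof (rule ccontr)
      assume "\<not> ?thesis"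
      then have "(M j <#> (V j #> s)) \<inter> (M j <#> (V j' #> s')) = {}"
        using patches_disjoint[OF T that(1,2) _ that(3)] by blast
      moreover have "m \<otimes> (w \<otimes> s) \<in> M j <#> (V j #> s)"
        using that by (intro set_multI) (auto simp: mem_translate)
      moreover have "m' \<otimes> (w' \<otimes> s') \<in> M j <#> (V j' #> s')"
        using that by (intro set_multI) (auto simp: mem_translate)
      ultimately show False using that by (metis IntI empty_iff)
    qed
    have same1: "j = j' \<and> s = s'"
      if "(j, s) \<in> patches T 0" "(j', s') \<in> patches T 0" "w \<in> V j" "w' \<in> V j'" "w \<otimes> s = w' \<otimes> s'"
      for j s j' s' w w'
    proof (cases "j \<le> j'")
      case True
      have "\<one> \<in> M j" using level_sets(8) Tc that by blast
      then show ?thesis using same[OF that(1,2) True _ _ that(3,4), of \<one> \<one>] that(5) by simp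
    next
      case False
      have "\<one> \<in> M j'" using level_sets(8) Tc that by blast
      then show ?thesis using same[OF that(2,1) _ _ _ that(4,3), of \<one> \<one>] that(5) False by simp
    qed
    have c_eq: "c (w \<otimes> s) = p j w l" if js: "(j, s) \<in> patches T 0" "l < j" "w \<in> V j" for j s w
      unfolding c_def
    proof (rule some_equality)
      show "\<exists>j' s' w'. (j', s') \<in> patches T 0 \<and> l < j' \<and> w' \<in> V j' \<and> w \<otimes> s = w' \<otimes> s' \<and> p j w l = p j' w' l"
        using js by blast
      fix x assume "\<exists>j' s' w'. (j', s') \<in> patches T 0 \<and> l < j' \<and> w' \<in> V j' \<and> w \<otimes> s = w' \<otimes> s' \<and> x = p j' w' l"
      then obtain j' s' w' where *: "(j', s') \<in> patches T 0" "w' \<in> V j'" "w \<otimes> s = w' \<otimes> s'" "x = p j' w' l" by blast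
      then have e: "j = j'" "s = s'" using same1[OF js(1) *(1) js(3) *(2,3)] by auto
      have "w \<in> carrier G" "w' \<in> carrier G" "s \<in> carrier G"
        using level_sets(2) Tc js * e by blast+
      then have "w = w'" using * e by simp
      then show "x = p j w l" using * e by simp
    qed
    have P_mem: "u \<in> P \<longleftrightarrow> (\<exists>j s w. (j, s) \<in> patches T 0 \<and> l < j \<and> w \<in> V j \<and> u = w \<otimes> s)" for u
      unfolding P_def by (auto simp: mem_translate)
    have prp: "proper \<gamma> j (V j) (p j)" if "j \<le> k" for j
      using levels[OF that] by (simp add: level_ok_def)
    have "P \<subseteq> occupied T 0" unfolding P_def occupied_eq_patches by blast
    then have "P \<subseteq> area T 0" by (auto simp: area_def)
    moreover have "c u < 3" if "u \<in> P" for u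
    proof -
      obtain j s w where js: "(j, s) \<in> patches T 0" "l < j" "w \<in> V j" "u = w \<otimes> s" using \<open>u \<in> P\<close> P_mem by blast
      then show ?thesis using prp[of j] Tc c_eq[OF js(1-3)] by (simp add: proper_def)
    qed
    moreover have "c u \<noteq> c (\<gamma> l \<otimes> u)" if u: "u \<in> P" "\<gamma> l \<otimes> u \<in> P" for u
    proof -
      obtain j s w where js: "(j, s) \<in> patches T 0" "l < j" "w \<in> V j" "u = w \<otimes> s" using u P_mem by blast
      obtain j' s' w' where js': "(j', s') \<in> patches T 0" "l < j'" "w' \<in> V j'" "\<gamma> l \<otimes> u = w' \<otimes> s'" using u P_mem by blast
      have c: "w \<in> carrier G" "w' \<in> carrier G" "s \<in> carrier G" "s' \<in> carrier G"
        using level_sets(2) Tc js js' by blast+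
      have Mj: "\<gamma> l \<in> M j" "\<one> \<in> M j" "\<gamma> l \<in> M j'" "\<one> \<in> M j'"
        using level_below(1) level_sets(8) Tc js js' by blast+
      have "j = j' \<and> s = s'"
      proof (cases "j \<le> j'")
        case True
        then show ?thesis using same[OF js(1) js'(1) True Mj(1,2) js(3) js'(3)] js js' c by simp
      next
        case False
        then show ?thesis using same[OF js'(1) js(1) _ Mj(4,3) js'(3) js(3)] js js' c by simp
      qed
      then have e: "j' = j" "s' = s" by auto
      have "(\<gamma> l \<otimes> w) \<otimes> s = w' \<otimes> s" using js js' c \<gamma>(1) e by (simp add: m_assoc)
      then have w': "w' = \<gamma> l \<otimes> w" using c \<gamma>(1) by simp
      have "p j w l \<noteq> p j w' l" using prp[of j] Tc js js' e w' by (auto simp: proper_def)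
      then show ?thesis using c_eq[OF js(1-3)] c_eq[OF js'(1-3)] js(4) js'(4) e by simp
    qed
    ultimately obtain c' where c': "\<forall>u\<in>P. c' u = c u"
        "\<forall>u\<in>area T 0. c' u < 3 \<and> (\<gamma> l \<otimes> u \<in> area T 0 \<longrightarrow> c' u \<noteq> c' (\<gamma> l \<otimes> u))"
      using extend_three_colouring[OF area_finite[OF T, of 0] area_closed[OF T, of 0] \<gamma>, of P c] by blast
    have "c' (w \<otimes> s) = p j w l" if "(j, s) \<in> patches T 0" "w \<in> V j" "l < j" for j s w
      using c' c_eq[OF that(1,3,2)] P_mem that by metis
    then show ?thesis using c' by (intro exI[of _ c']) auto
  qed
  note ex = this
  from choice[OF allI[OF ex]] obtain c where
    c: "\<forall>l. (\<forall>(j, s)\<in>patches T 0. \<forall>w\<in>V j. l < j \<longrightarrow> c l (w \<otimes> s) = p j w l) \<and>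
      (\<forall>u\<in>area T 0. c l u < 3 \<and> (\<gamma> l \<otimes> u \<in> area T 0 \<longrightarrow> c l u \<noteq> c l (\<gamma> l \<otimes> u)))" by (rule exE)
  show ?thesis
  proof (intro exI[of _ "\<lambda>u l. c l u"] conjI)
    show "proper \<gamma> (Suc k) (area T 0) (\<lambda>u l. c l u)" unfolding proper_def using c by blast
    show "\<forall>(j, s)\<in>patches T 0. \<forall>w\<in>V j. \<forall>l<j. c l (w \<otimes> s) = p j w l" using c by blast
  qed
qed

lemma occupied_Suc:
  assumes "i \<le> k"
  shows "occupied T i = occupied T (Suc i) \<union> (V i <#> T i)"
proof -
  have "{i..k} = insert i {Suc i..k}" using assms by auto
  then show ?thesis by (auto simp: occupied_def)
qed

text \<open>A translate \<open>F g\<close> of level \<open>i\<close> that is more than half blocked by the area is not blocked by the copies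
  of levels up to \<open>i\<close> alone, as these are sparse. Thus it comes near the area of the higher
  levels. If the higher copies leave half of it free, then a copy of level \<open>i\<close> was placed on it.
  Otherwise these copies block more than half of it; by the size of their margins just one copy
  does so, and robustness of the pattern of that copy gives the occurrence.\<close>

lemma robust_area:
  assumes T: "\<And>l. l \<le> k \<Longrightarrow> placed T l" and i: "i \<le> k"
    and q: "\<And>j s w l. (j, s) \<in> patches T 0 \<Longrightarrow> w \<in> V j \<Longrightarrow> l < j \<Longrightarrow> q (w \<otimes> s) l = p j w l"
  shows "robust i (f i) (area T 0) q"
  unfolding robust_def
proof (intro ballI impI)
  fix g assume g: "g \<in> carrier G" and big: "2 * t i < card ((F i #> g) \<inter> (L i <#> area T 0))"
  let ?e = "F i #> g"
  let ?A = "area T (Suc i)"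
  let ?U = "occupied T (Suc i)"
  note ls = level_sets[OF i]
  have Tc: "T l \<subseteq> carrier G" if "l \<le> k" for l using T[OF that] by (simp add: placed_def)
  have fin: "finite (?e \<inter> B)" for B using finite_translate[OF ls(4)] by simp
  have pl: "placed T i" by (rule T[OF i])
  have Ac: "?A \<subseteq> carrier G" by (rule area_closed[OF T])
  have mono0: "patches T (Suc i) \<subseteq> patches T 0" by (auto simp: patches_def)
  have in_area: "V j #> s \<subseteq> area T 0" if "(j, s) \<in> patches T 0" for j s
    using that unfolding area_def occupied_eq_patches by blast
  have "L i <#> area T 0 \<subseteq> L i <#> (K i <#> (?A \<union> (V i <#> T i)))"
    using area_subset_reach[OF T i] occupied_Suc[OF i, of T]
    by (intro mono_set_mult subset_refl) (simp add: area_def)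
  also have "\<dots> = (L i <#> (K i <#> ?A)) \<union> (L i <#> (K i <#> (V i <#> T i)))"
    by (simp add: set_mult_Un_right)
  finally have cover: "L i <#> area T 0 \<subseteq> (L i <#> (K i <#> ?A)) \<union> (L i <#> (K i <#> (V i <#> T i)))" .
  \<comment> \<open>sparseness of level \<open>i\<close> excludes that only the copies of level \<open>i\<close>, with all that is filled in around them, block the translate\<close>
  have touch: "?e \<inter> (L i <#> (K i <#> ?A)) \<noteq> {}"
  proof
    assume "?e \<inter> (L i <#> (K i <#> ?A)) = {}"
    then have "?e \<inter> (L i <#> area T 0) \<subseteq> ?e \<inter> (L i <#> (K i <#> (V i <#> T i)))" using cover by blast
    then have "card (?e \<inter> (L i <#> area T 0)) \<le> card (?e \<inter> (L i <#> (K i <#> (V i <#> T i))))"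
      using fin by (intro card_mono)
    also have "\<dots> \<le> 2 * t i" using pl g by (simp add: placed_def)
    finally show False using big by simp
  qed
  show "\<exists>\<sigma>\<in>F i. occurs i (f i) (area T 0) q (\<sigma> \<otimes> g)"
  proof (cases "card (?e \<inter> (L i <#> ?U)) \<le> 2 * t i")
    case True
    have "\<forall>g\<in>carrier G. (F i #> g) \<inter> (L i <#> (K i <#> area T (Suc i))) \<noteq> {} \<longrightarrow>
        card ((F i #> g) \<inter> (L i <#> occupied T (Suc i))) \<le> 2 * t i \<longrightarrow> (F i #> g) \<inter> T i \<noteq> {}"
      using pl unfolding placed_def by (elim conjE)
    with g touch True have "?e \<inter> T i \<noteq> {}" by simp
    then obtain s where s: "s \<in> ?e" "s \<in> T i" by blast
    then obtain \<sigma> where \<sigma>: "\<sigma> \<in> F i" "s = \<sigma> \<otimes> g" by (auto simp: mem_translate)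
    have P: "(i, s) \<in> patches T 0" using s i by (auto simp: patches_def)
    have "w \<otimes> s \<in> area T 0" if "w \<in> V i" for w
      using subsetD[OF in_area[OF P] translateI[OF that]] .
    then have "occurs i (f i) (area T 0) q s"
      unfolding occurs_def using q[OF P] by simp
    then show ?thesis using \<sigma> by blast
  next
    case False
    then have "?e \<inter> (L i <#> ?U) \<noteq> {}" by (intro notI) simp
    then obtain x where x: "x \<in> ?e" "x \<in> L i <#> ?U" by blast
    have in_patch: "\<exists>(j, s)\<in>patches T (Suc i). y \<in> L i <#> (V j #> s)" if "y \<in> L i <#> ?U" for y
      using that unfolding occupied_eq_patches by (fastforce simp: mem_set_mult)
    from in_patch[OF x(2)] obtain j s where P: "(j, s) \<in> patches T (Suc i)" "x \<in> L i <#> (V j #> s)" by blast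
    have pk: "j' \<le> k \<and> s' \<in> carrier G \<and> (i < k \<longrightarrow> i < j')" if "(j', s') \<in> patches T (Suc i)" for j' s'
      using that Tc by (auto simp: patches_def)
    have in_M: "g \<in> M m <#> (V j' #> s')"
      if "(j', s') \<in> patches T (Suc i)" and y: "y \<in> ?e" "y \<in> L i <#> (V j' #> s')" and "i < m" "m \<le> k"
      for j' s' y m
    proof -
      obtain \<sigma> where \<sigma>: "\<sigma> \<in> F i" "y = \<sigma> \<otimes> g" using y by (auto simp: mem_translate)
      obtain l v where lv: "l \<in> L i" "v \<in> V j' #> s'" "y = l \<otimes> v" using y by (auto simp: mem_set_mult)
      have "V j' #> s' \<subseteq> carrier G"
        using pk[OF that(1)] level_sets(2)[of j'] by (intro r_coset_subset_G) auto
      then have c: "\<sigma> \<in> carrier G" "l \<in> carrier G" "v \<in> carrier G" using \<sigma> lv ls by auto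
      have "(inv \<sigma> \<otimes> l) \<otimes> v = inv \<sigma> \<otimes> y" using c lv by (simp add: m_assoc)
      also have "\<dots> = g" unfolding \<sigma>(2) using c g by (simp add: m_assoc[symmetric])
      finally have "g = (inv \<sigma> \<otimes> l) \<otimes> v" by simp
      moreover have "inv \<sigma> \<otimes> l \<in> M m"
        using level_below(2)[OF \<open>m \<le> k\<close> \<open>i < m\<close>] \<sigma> lv by (blast intro: set_multI imageI)
      ultimately show ?thesis using lv by (simp add: set_multI)
    qed
    \<comment> \<open>two different copies blocking the same translate would have \<open>g\<close> in both of their margins\<close>
    have uniq: "(j', s') = (j, s)"
      if P': "(j', s') \<in> patches T (Suc i)" and y: "y \<in> ?e" "y \<in> L i <#> (V j' #> s')" for j' s' y
    proof (rule ccontr)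
      assume ne: "(j', s') \<noteq> (j, s)"
      have "i \<noteq> k"
      proof
        assume "i = k"
        then show False using ne P P' by (auto simp: patches_def)
      qed
      then have ij: "i < j" "i < j'" "j \<le> k" "j' \<le> k" using pk[OF P(1)] pk[OF P'] i by auto
      have P0: "(j, s) \<in> patches T 0" "(j', s') \<in> patches T 0" using P P' mono0 by auto
      show False
      proof (cases "j \<le> j'")
        case True
        then show False using patches_disjoint[OF T P0 _ True] ne
            in_M[OF P(1) x(1) P(2) ij(1,3)] in_M[OF P' y ij(1,3)] by auto
      next
        case False
        then have "j' \<le> j" by simp
        then show False using patches_disjoint[OF T P0(2,1) ne]
            in_M[OF P(1) x(1) P(2) ij(2,4)] in_M[OF P' y ij(2,4)] by auto
      qed
    qed
    have "?e \<inter> (L i <#> ?U) \<subseteq> ?e \<inter> (L i <#> (V j #> s))"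
    proof
      fix y assume y: "y \<in> ?e \<inter> (L i <#> ?U)"
      then obtain j' s' where "(j', s') \<in> patches T (Suc i)" "y \<in> L i <#> (V j' #> s')"
        using in_patch[of y] by blast
      then show "y \<in> ?e \<inter> (L i <#> (V j #> s))" using uniq[of j' s' y] y by auto
    qed
    then have "card (?e \<inter> (L i <#> ?U)) \<le> card (?e \<inter> (L i <#> (V j #> s)))" using fin by (intro card_mono)
    then have big': "2 * t i < card (?e \<inter> (L i <#> (V j #> s)))" using False by simp
    have jk: "j \<le> k" "s \<in> carrier G" using pk[OF P(1)] by auto
    note lj = level_sets[OF jk(1)]
    let ?g = "g \<otimes> inv s"
    have gc: "?g \<in> carrier G" using g jk by simp
    have gs: "?g \<otimes> s = g" using g jk by (simp add: m_assoc)
    have "?e \<inter> (L i <#> (V j #> s)) = ((F i #> ?g) \<inter> (L i <#> V j)) #> s"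
    proof -
      have e1: "?e = (F i #> ?g) #> s" using coset_mult_assoc[OF ls(5) gc jk(2)] gs by simp
      have e2: "L i <#> (V j #> s) = (L i <#> V j) #> s"
        using ls lj jk by (simp add: translate_eq_set_mult set_mult_assoc)
      have "(A #> s) \<inter> (B #> s) = (A \<inter> B) #> s" if AB: "A \<subseteq> carrier G" "B \<subseteq> carrier G" for A B
      proof
        show "(A #> s) \<inter> (B #> s) \<subseteq> (A \<inter> B) #> s"
        proof
          fix x assume "x \<in> (A #> s) \<inter> (B #> s)"
          then obtain a b where ab: "a \<in> A" "b \<in> B" "x = a \<otimes> s" "x = b \<otimes> s" by (auto simp: mem_translate)
          then have "a \<in> carrier G" "b \<in> carrier G" "a \<otimes> s = b \<otimes> s" using AB by auto
          then have "a = b" using jk by simp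
          then show "x \<in> (A \<inter> B) #> s" using ab by (auto simp: mem_translate)
        qed
      qed (auto simp: mem_translate)
      then show ?thesis unfolding e1 e2 using ls lj gc
        by (meson r_coset_subset_G set_mult_closed)
    qed
    moreover have "(F i #> ?g) \<inter> (L i <#> V j) \<subseteq> carrier G"
      using ls gc by (meson inf.coboundedI1 r_coset_subset_G)
    ultimately have big'': "2 * t i < card ((F i #> ?g) \<inter> (L i <#> V j))"
      using big' card_translate jk by simp
    have P0: "(j, s) \<in> patches T 0" using P mono0 by auto
    show ?thesis
    proof (cases "i < j")
      case True
      obtain \<sigma> where \<sigma>: "\<sigma> \<in> F i" "occurs i (f i) (V j) (p j) (\<sigma> \<otimes> ?g)"
        using level_below(4)[OF jk(1) True] gc big'' unfolding robust_def by blast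
      have \<sigma>c: "\<sigma> \<in> carrier G" using \<sigma> ls by auto
      have "w \<otimes> (\<sigma> \<otimes> g) \<in> area T 0 \<and> (\<forall>l<i. q (w \<otimes> (\<sigma> \<otimes> g)) l = p i w l)" if w: "w \<in> V i" for w
      proof -
        let ?w = "w \<otimes> (\<sigma> \<otimes> ?g)"
        have wc: "w \<in> carrier G" using w ls by auto
        have eq: "w \<otimes> (\<sigma> \<otimes> g) = ?w \<otimes> s" using wc \<sigma>c g jk by (simp add: m_assoc)
        have *: "?w \<in> V j" "\<And>l. l < i \<Longrightarrow> p j ?w l = p i w l" using \<sigma>(2) w by (auto simp: occurs_def)
        have "?w \<otimes> s \<in> area T 0" using subsetD[OF in_area[OF P0] translateI[OF *(1)]] .
        moreover have "q (?w \<otimes> s) l = p i w l" if "l < i" for l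
          using q[OF P0 *(1), of l] *(2) that True by simp
        ultimately show ?thesis unfolding eq by blast
      qed
      then show ?thesis using \<sigma>(1) unfolding occurs_def by blast
    next
      case False
      then have ij: "i = k" "j = k" using P i by (auto simp: patches_def)
      have "card ((F i #> ?g) \<inter> (L i <#> V j)) \<le> card (L k <#> V k)"
        unfolding ij using level_sets[of k] by (intro card_mono finite_set_mult) auto
      also have "\<dots> \<le> 2 * t k" using levels[of k] by (simp add: level_ok_def)
      finally show ?thesis using big'' ij by simp
    qed
  qed
qed

text \<open>The positions are chosen level by level, the gaps are coloured greedily, and the invariant
  survives. This is the inductive step of the whole construction.\<close>

lemma extend_tower:
  "\<exists>W q. finite W \<and> W \<subseteq> carrier G \<and> V k \<subseteq> W \<and> \<gamma> k \<in> W \<and> proper \<gamma> (Suc k) W q \<and>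
     (\<forall>w\<in>V k. \<forall>l<k. q w l = p k w l) \<and> (\<forall>i\<le>k. robust i (f i) W q)"
proof -
  obtain T where T: "\<And>i. i \<le> k \<Longrightarrow> placed T i" using ex_placement by blast
  obtain q where q: "proper \<gamma> (Suc k) (area T 0) q"
      "\<And>j s w l. (j, s) \<in> patches T 0 \<Longrightarrow> w \<in> V j \<Longrightarrow> l < j \<Longrightarrow> q (w \<otimes> s) l = p j w l"
    using ex_filling[OF T] by blast
  have "q w l = p k w l" if "w \<in> V k" "l < k" for w l
  proof -
    have "w \<in> carrier G" using that level_sets(2)[of k] by auto
    then show ?thesis using q(2)[of k \<one> w l] that by (simp add: patches_def)
  qed
  moreover have "V k \<subseteq> area T 0" "\<gamma> k \<in> area T 0" by (auto simp: area_def occupied_def)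
  ultimately show ?thesis
    using robust_area[OF T _ q(2)] q(1) area_finite[OF T, of 0] area_closed[OF T, of 0]
    by (intro exI[of _ "area T 0"] exI[of _ q] conjI) auto
qed

end

section \<open>The recurrent colouring\<close>

lemma unbounded_family_card:
  assumes "unbounded_family \<F>"
  shows "\<exists>F\<in>\<F>. n \<le> card F"
proof (rule ccontr)
  assume "\<not> ?thesis"
  then have "(SUP F\<in>\<F>. enat (card F)) \<le> enat n"
    by (intro SUP_least) auto
  then show False using assms by (simp add: unbounded_family_def)
qed

context group
begin

text \<open>Window, pattern, margin and reach are fixed first, and the size of the set \<open>shifts d\<close> is adapted to
  them. It is found inside a member of the given family because that family is unbounded.\<close>

lemma complete_level:
  assumes W: "finite W" "W \<subseteq> carrier G" "\<one> \<in> W"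
    and M: "finite M" "M \<subseteq> carrier G"
    and K: "finite K" "K \<subseteq> carrier G" "\<one> \<in> K"
    and \<G>: "unbounded_family \<G>" "\<And>F. F \<in> \<G> \<Longrightarrow> finite F \<and> F \<subseteq> carrier G"
  shows "\<exists>d::'a level. window d = W \<and> pattern d = q \<and> margin d = M \<and> reach d = K \<and>
    finite (shifts d) \<and> shifts d \<subseteq> carrier G \<and> 2 * threshold d < card (shifts d) \<and>
    hitting d \<and> card (conflict d <#> window d) \<le> 2 * threshold d \<and> (\<exists>F\<in>\<G>. shifts d \<subseteq> F)"
proof -
  define L where "L = (m_inv G ` W) <#> ((m_inv G ` M) <#> M)"
  define E0 where "E0 = L <#> (K <#> W)"
  \<comment> \<open>the symmetric neighbourhood that covers both the separation and the sparseness required of copies\<close>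
  define E where "E = insert \<one> (E0 \<union> m_inv G ` E0)"
  have L: "finite L" "L \<subseteq> carrier G"
    unfolding L_def by (intro finite_set_mult set_mult_closed inv_image_closed finite_imageI W M)+
  have E0: "finite E0" "E0 \<subseteq> carrier G"
    unfolding E0_def by (intro finite_set_mult set_mult_closed L K W)+
  have E: "finite E" "E \<subseteq> carrier G" "\<one> \<in> E" using E0 by (auto simp: E_def)
  have Einv: "m_inv G ` E \<subseteq> E" using E0 by (auto simp: E_def)
  obtain t where t: "card E \<le> t" and
    hit: "\<forall>F. finite F \<and> F \<subseteq> carrier G \<and> card F = 4 * t \<and>
        (\<forall>\<sigma>\<in>F. \<forall>\<tau>\<in>F. \<sigma> \<noteq> \<tau> \<longrightarrow> (E #> \<sigma>) \<inter> (E #> \<tau>) = {}) \<longrightarrow>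
      (\<forall>B Q. finite Q \<and> Q \<subseteq> carrier G \<longrightarrow>
        (\<exists>S. finite S \<and> S \<subseteq> carrier G - B \<and>
          (\<forall>s\<in>S. \<forall>s'\<in>S. s \<noteq> s' \<longrightarrow> s' \<notin> E #> s) \<and>
          (\<forall>g\<in>carrier G. card ((F #> g) \<inter> (E <#> S)) \<le> t) \<and>
          (\<forall>g\<in>Q. card ((F #> g) - B) \<ge> 2 * t \<longrightarrow> (F #> g) \<inter> S \<noteq> {})))"
    using sparse_hitting_set[OF E(2,1,3) Einv] by (elim exE conjE) (rule that)
  have "card E > 0" using E by (auto simp: card_gt_0_iff)
  then have t1: "t > 0" using t by simp
  obtain F0 where F0: "F0 \<in> \<G>" "(4 * t) * (card E * card E) + 4 * t \<le> card F0"
    using unbounded_family_card[OF \<G>(1)] by blast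
 have F0f: "finite F0" "F0 \<subseteq> carrier G" using \<G>(2)[OF F0(1)] by auto
  obtain F where F: "F \<subseteq> F0" "card F = 4 * t"
     "\<forall>\<sigma>\<in>F. \<forall>\<tau>\<in>F. \<sigma> \<noteq> \<tau> \<longrightarrow> (E #> \<sigma>) \<inter> (E #> \<tau>) = {}"
    using separated_subset[OF E(2,1) F0f(2,1) F0(2)] by (elim exE conjE) (rule that)
  have Ff: "finite F" "F \<subseteq> carrier G" using F \<G>(2)[OF F0(1)] finite_subset by auto
  define d :: "'a level" where
    "d = \<lparr>window = W, pattern = q, shifts = F, threshold = t, margin = M, reach = K\<rparr>"
  have d[simp]: "window d = W" "pattern d = q" "shifts d = F" "threshold d = t" "margin d = M" "reach d = K"
    by (simp_all add: d_def)
  have cd: "conflict d = L" by (simp add: conflict_def L_def)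
  have "hitting d"
    unfolding hitting_def cd d
  proof (intro allI impI)
    fix B Q assume Q: "finite Q \<and> Q \<subseteq> carrier G"
    from hit[THEN spec, THEN mp, OF conjI[OF Ff(1) conjI[OF Ff(2) conjI[OF F(2,3)]]], THEN spec, THEN spec, THEN mp, OF Q, of B]
    obtain S where S: "finite S" "S \<subseteq> carrier G - B"
      and S3: "\<forall>s\<in>S. \<forall>s'\<in>S. s \<noteq> s' \<longrightarrow> s' \<notin> E #> s"
      and S4: "\<forall>g\<in>carrier G. card ((F #> g) \<inter> (E <#> S)) \<le> t"
      and S5: "\<forall>g\<in>Q. card ((F #> g) - B) \<ge> 2 * t \<longrightarrow> (F #> g) \<inter> S \<noteq> {}"
      by (elim exE conjE) metis
    show "\<exists>S. finite S \<and> S \<subseteq> carrier G - B \<and>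
       (\<forall>s\<in>S. \<forall>s'\<in>S. s \<noteq> s' \<longrightarrow> (M <#> (W #> s)) \<inter> (M <#> (W #> s')) = {}) \<and>
       (\<forall>g\<in>carrier G. card ((F #> g) \<inter> (L <#> (K <#> (W <#> S)))) \<le> 2 * t) \<and>
       (\<forall>g\<in>Q. card ((F #> g) \<inter> B) \<le> 2 * t \<longrightarrow> (F #> g) \<inter> S \<noteq> {})"
    proof (intro exI[of _ S] conjI ballI impI S)
      fix s s' assume s: "s \<in> S" "s' \<in> S" "s \<noteq> s'"
      show "(M <#> (W #> s)) \<inter> (M <#> (W #> s')) = {}"
      proof (rule ccontr)
        assume "(M <#> (W #> s)) \<inter> (M <#> (W #> s')) \<noteq> {}"
        then obtain x where "x \<in> M <#> (W #> s)" "x \<in> M <#> (W #> s')" by blast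
        then obtain m w m' w' where *: "m \<in> M" "w \<in> W" "m' \<in> M" "w' \<in> W" "m \<otimes> (w \<otimes> s) = m' \<otimes> (w' \<otimes> s')"
          by (auto simp: mem_set_mult mem_translate)
        have c: "m \<in> carrier G" "w \<in> carrier G" "m' \<in> carrier G" "w' \<in> carrier G" "s \<in> carrier G" "s' \<in> carrier G"
          using * M W s S by auto
        have "((inv w' \<otimes> (inv m' \<otimes> m)) \<otimes> (\<one> \<otimes> w)) \<otimes> s = inv w' \<otimes> (inv m' \<otimes> (m \<otimes> (w \<otimes> s)))"
          using c by (simp add: m_assoc)
        also have "\<dots> = s'" unfolding *(5) using c
          by (metis inv_closed l_inv l_one m_assoc m_closed)
        finally have "s' = ((inv w' \<otimes> (inv m' \<otimes> m)) \<otimes> (\<one> \<otimes> w)) \<otimes> s" by simp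
        moreover have "(inv w' \<otimes> (inv m' \<otimes> m)) \<otimes> (\<one> \<otimes> w) \<in> E0"
          unfolding E0_def L_def by (intro set_multI imageI * K)
        ultimately have "s' \<in> E #> s" by (auto simp: E_def mem_translate)
        then show False using S3 s by blast
      qed
    next
      fix g assume g: "g \<in> carrier G"
      have "L <#> (K <#> (W <#> S)) = E0 <#> S"
      proof -
        have "S \<subseteq> carrier G" using S by blast
        then show ?thesis
          unfolding E0_def using L K W by (simp add: set_mult_assoc set_mult_closed)
      qed
      also have "\<dots> \<subseteq> E <#> S" by (intro mono_set_mult) (auto simp: E_def)
      finally have "card ((F #> g) \<inter> (L <#> (K <#> (W <#> S)))) \<le> card ((F #> g) \<inter> (E <#> S))"
        using finite_translate[OF Ff(1)] by (intro card_mono) auto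
      then show "card ((F #> g) \<inter> (L <#> (K <#> (W <#> S)))) \<le> 2 * t" using S4 g by fastforce
    next
      fix g assume g: "g \<in> Q" "card ((F #> g) \<inter> B) \<le> 2 * t"
      have "card (F #> g) = 4 * t" using card_translate[OF Ff(2)] F(2) g Q by auto
      moreover have "card (F #> g) = card ((F #> g) - B) + card ((F #> g) \<inter> B)"
        using finite_translate[OF Ff(1)] by (metis Int_Diff_Un Int_Diff_disjoint add.commute card_Un_disjoint finite_Diff finite_Int)
      ultimately show "(F #> g) \<inter> S \<noteq> {}" using S5 g by simp
    qed
  qed
  moreover have "L <#> W \<subseteq> E"
  proof -
    have "W \<subseteq> K <#> W" using subset_set_mult_one[OF K(3) W(2)] .
    then have "L <#> W \<subseteq> E0" unfolding E0_def by (intro mono_set_mult) auto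
    then show ?thesis by (auto simp: E_def)
  qed
  from card_mono[OF E(1) this] have "card (conflict d <#> window d) \<le> 2 * threshold d"
    using t unfolding cd d by simp
  ultimately show ?thesis
    using Ff F F0 t1 by (intro exI[of _ d]) auto
qed

text \<open>The requirements on a level involve only lower levels, so levels can be chosen by recursion on their
  index; the window and the pattern come from \<open>extend_tower\<close>.\<close>

lemma ex_tower:
  assumes \<gamma>: "\<And>l. \<gamma> l \<in> carrier G" "\<And>l. \<gamma> l \<noteq> \<one>"
    and \<G>: "\<And>k. unbounded_family (\<G> k)" "\<And>k F. F \<in> \<G> k \<Longrightarrow> finite F \<and> F \<subseteq> carrier G"
  shows "\<exists>f. \<forall>k. level_ok \<gamma> f k (f k) \<and> (\<exists>F\<in>\<G> k. shifts (f k) \<subseteq> F)"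
proof (rule dependent_wellorder_choice)
  show "(level_ok \<gamma> f k d \<and> (\<exists>F\<in>\<G> k. shifts d \<subseteq> F)) = (level_ok \<gamma> g k d \<and> (\<exists>F\<in>\<G> k. shifts d \<subseteq> F))"
    if "\<And>i. i < k \<Longrightarrow> f i = g i" for d f g k
    using that by (simp add: level_ok_def cong: imp_cong)
  fix k f assume IH: "\<And>i. i < k \<Longrightarrow> level_ok \<gamma> f i (f i) \<and> (\<exists>F\<in>\<G> i. shifts (f i) \<subseteq> F)"
  define M where "M = insert \<one> (\<gamma> ` {..<k} \<union> (\<Union>i<k. (m_inv G ` shifts (f i)) <#> conflict (f i)))"
  define K where "K = insert \<one> (\<Union>i<k. reach (f i) <#> insert \<one> (window (f i) <#> near (f i)))"
  have "\<exists>W q. finite W \<and> W \<subseteq> carrier G \<and> \<one> \<in> W \<and> proper \<gamma> k W q \<and> (\<forall>i<k. robust i (f i) W q) \<and>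
     (\<forall>i. Suc i = k \<longrightarrow> window (f i) \<subseteq> W \<and> \<gamma> i \<in> W \<and> (\<forall>w\<in>window (f i). \<forall>l<i. q w l = pattern (f i) w l))"
  proof (cases k)
    case 0
    then show ?thesis by (intro exI[of _ "{\<one>}"]) (auto simp: proper_def)
  next
    case (Suc j)
    interpret tower G \<gamma> f j
      by unfold_locales (use IH \<gamma> Suc in auto)
    obtain W q where "finite W" "W \<subseteq> carrier G" "window (f j) \<subseteq> W" "\<gamma> j \<in> W" "proper \<gamma> (Suc j) W q"
       "\<forall>w\<in>window (f j). \<forall>l<j. q w l = pattern (f j) w l" "\<forall>i\<le>j. robust i (f i) W q"
      using extend_tower by blast
    moreover have "\<one> \<in> window (f j)" using level_sets(3)[of j] by simp
    ultimately show ?thesis unfolding Suc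
      by (intro exI[of _ W] exI[of _ q]) (auto simp: less_Suc_eq_le)
  qed
  then obtain W q where W: "finite W" "W \<subseteq> carrier G" "\<one> \<in> W" and q: "proper \<gamma> k W q" "\<forall>i<k. robust i (f i) W q"
     "\<forall>i. Suc i = k \<longrightarrow> window (f i) \<subseteq> W \<and> \<gamma> i \<in> W \<and> (\<forall>w\<in>window (f i). \<forall>l<i. q w l = pattern (f i) w l)"
    by blast
  have fin: "finite ((m_inv G ` shifts (f i)) <#> conflict (f i))"
      "(m_inv G ` shifts (f i)) <#> conflict (f i) \<subseteq> carrier G"
      "finite (reach (f i) <#> insert \<one> (window (f i) <#> near (f i)))"
      "reach (f i) <#> insert \<one> (window (f i) <#> near (f i)) \<subseteq> carrier G" if "i < k" for i
  proof -
    interpret tower G \<gamma> f i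
      by unfold_locales (use IH \<gamma> that in auto)
    note ls = level_sets[OF order_refl]
    show "finite ((m_inv G ` shifts (f i)) <#> conflict (f i))"
      by (intro finite_set_mult finite_imageI ls)
    show "(m_inv G ` shifts (f i)) <#> conflict (f i) \<subseteq> carrier G"
      by (intro set_mult_closed inv_image_closed ls)
    show "finite (reach (f i) <#> insert \<one> (window (f i) <#> near (f i)))"
      by (intro finite_set_mult finite.insertI ls)
    have "window (f i) <#> near (f i) \<subseteq> carrier G" by (intro set_mult_closed ls)
    then show "reach (f i) <#> insert \<one> (window (f i) <#> near (f i)) \<subseteq> carrier G"
      by (intro set_mult_closed ls) auto
  qed
  have M: "finite M" "M \<subseteq> carrier G" using fin(1,2) \<gamma> by (auto simp: M_def)
  have K: "finite K" "K \<subseteq> carrier G" "\<one> \<in> K" using fin(3,4) by (auto simp: K_def)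
  obtain d :: "'a level" where d: "window d = W" "pattern d = q" "margin d = M" "reach d = K"
    "finite (shifts d)" "shifts d \<subseteq> carrier G" "2 * threshold d < card (shifts d)"
    "hitting d" "card (conflict d <#> window d) \<le> 2 * threshold d" "\<exists>F\<in>\<G> k. shifts d \<subseteq> F"
    using complete_level[OF W M K \<G>(1)[of k] \<G>(2)[of _ k], of q] by auto
  have "level_ok \<gamma> f k d"
    unfolding level_ok_def
  proof (intro conjI allI impI)
    show "finite (window d)" "window d \<subseteq> carrier G" "\<one> \<in> window d" using W d by simp_all
    show "finite (margin d)" "margin d \<subseteq> carrier G" "\<one> \<in> margin d" using M d by (simp_all add: M_def)
    show "finite (reach d)" "reach d \<subseteq> carrier G" "\<one> \<in> reach d" using K d by simp_all
    show "proper \<gamma> k (window d) (pattern d)" using q d by simp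
    fix i assume i: "i < k"
    show "\<gamma> i \<in> margin d" "(m_inv G ` shifts (f i)) <#> conflict (f i) \<subseteq> margin d"
      using i unfolding d M_def by blast+
    show "reach (f i) <#> insert \<one> (window (f i) <#> near (f i)) \<subseteq> reach d"
      using i unfolding d K_def by blast
    show "robust i (f i) (window d) (pattern d)" using q(2) i d by simp
    assume "Suc i = k"
    then show "window (f i) \<subseteq> window d" "\<gamma> i \<in> window d"
        "\<forall>w\<in>window (f i). \<forall>l<i. pattern d w l = pattern (f i) w l"
      using q(3) d by auto
  qed (use d in simp_all)
  then show "\<exists>d. level_ok \<gamma> f k d \<and> (\<exists>F\<in>\<G> k. shifts d \<subseteq> F)" using d by blast
qed

text \<open>The patterns extend each other and their windows exhaust the group, so they have a union \<open>z\<close>. A translate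
  of \<open>shifts (f k)\<close> is finite and hence contained, and thereby completely blocked, in some later
  window; robustness yields an occurrence of the \<open>k\<close>-th pattern on it.\<close>

lemma ex_recurrent_colouring:
  assumes \<gamma>: "range \<gamma> = carrier G - {\<one>}"
    and \<G>: "\<And>k. unbounded_family (\<G> k)" "\<And>k F. F \<in> \<G> k \<Longrightarrow> finite F \<and> F \<subseteq> carrier G"
  shows "\<exists>(z :: 'a \<Rightarrow> nat \<Rightarrow> nat) V. incseq V \<and> (\<Union>k. V k) = carrier G \<and>
    (\<forall>u\<in>carrier G. \<forall>l. z u l < 3 \<and> z u l \<noteq> z (\<gamma> l \<otimes> u) l) \<and>
    (\<forall>k. \<exists>F\<in>\<G> k. \<forall>g\<in>carrier G. \<exists>\<sigma>\<in>F. \<forall>w\<in>V k. \<forall>l<k. z (w \<otimes> (\<sigma> \<otimes> g)) l = z w l)"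
proof -
  have \<gamma>': "\<gamma> l \<in> carrier G" "\<gamma> l \<noteq> \<one>" for l using \<gamma> by auto
  have "\<exists>f. \<forall>k. level_ok \<gamma> f k (f k) \<and> (\<exists>F\<in>\<G> k. shifts (f k) \<subseteq> F)"
    by (rule ex_tower) (use \<gamma>' \<G> in auto)
  then obtain f where f: "\<And>k. level_ok \<gamma> f k (f k)" "\<And>k. \<exists>F\<in>\<G> k. shifts (f k) \<subseteq> F"
    by blast
  have tow: "tower G \<gamma> f k" for k
    by unfold_locales (use f \<gamma>' in auto)
  define V where "V k = window (f k)" for k
  define p where "p k = pattern (f k)" for k
  have V_step: "V k \<subseteq> V (Suc k)" "\<gamma> k \<in> V (Suc k)"
    and p_step: "\<And>w l. w \<in> V k \<Longrightarrow> l < k \<Longrightarrow> p (Suc k) w l = p k w l" for k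
    using f(1)[of "Suc k"] by (auto simp: level_ok_def V_def p_def)
  have V: "V k \<subseteq> carrier G" "\<one> \<in> V k" and p_proper: "proper \<gamma> k (V k) (p k)" for k
    using f(1)[of k] by (auto simp: level_ok_def V_def p_def)
  have inc: "incseq V" by (rule incseq_SucI) (rule V_step(1))
  have un: "(\<Union>k. V k) = carrier G"
  proof
    show "(\<Union>k. V k) \<subseteq> carrier G" using V by blast
    show "carrier G \<subseteq> (\<Union>k. V k)"
    proof
      fix u assume u: "u \<in> carrier G"
      show "u \<in> (\<Union>k. V k)"
      proof (cases "u = \<one>")
        case False
        then obtain k where "u = \<gamma> k" using \<gamma> u by blast
        then show ?thesis using V_step(2) by blast
      qed (use V in blast)
    qed
  qed
  have agree: "p k' w l = p k w l" if "w \<in> V k" "l < k" "k \<le> k'" for k k' w l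
    using that(3)
  proof (induction k' rule: dec_induct)
    case (step n)
    have "w \<in> V n" using inc that step by (meson incseqD subsetD)
    then show ?case using p_step[of w n l] step that by simp
  qed simp
  define z where "z u l = (let k = (LEAST k. u \<in> V k \<and> l < k) in p k u l)" for u l
  have z: "z w l = p k w l" if "w \<in> V k" "l < k" for k w l
  proof -
    let ?k = "LEAST k. w \<in> V k \<and> l < k"
    have "w \<in> V ?k \<and> l < ?k" by (rule LeastI[of _ k]) (use that in auto)
    moreover have "?k \<le> k" by (rule Least_le) (use that in auto)
    ultimately show ?thesis using agree[of w ?k l k] by (simp add: z_def)
  qed
  have reachable: "\<exists>j>k. X \<subseteq> V j" if "finite X" "X \<subseteq> carrier G" for X k
    using that
  proof (induction X rule: finite_induct)
    case empty
    then show ?case by blast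
  next
    case (insert x X)
    then obtain j where j: "j > k" "X \<subseteq> V j" by auto
    obtain i where "x \<in> V i" using un insert.prems by blast
    moreover have "V i \<subseteq> V (max i j)" "V j \<subseteq> V (max i j)"
      by (rule incseqD[OF inc]; simp)+
    ultimately have "insert x X \<subseteq> V (max i j)" using j by blast
    then show ?case using j by (intro exI[of _ "max i j"]) auto
  qed
  show ?thesis
  proof (intro exI[of _ z] exI[of _ V] conjI inc un ballI allI)
    fix u l assume u: "u \<in> carrier G"
    obtain j where j: "j > l" "{u, \<gamma> l \<otimes> u} \<subseteq> V j" using reachable[of "{u, \<gamma> l \<otimes> u}" l] u \<gamma>' by blast
    then show "z u l < 3" "z u l \<noteq> z (\<gamma> l \<otimes> u) l"
      using p_proper[of j] z[of u j l] z[of "\<gamma> l \<otimes> u" j l] by (auto simp: proper_def)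
  next
    fix k
    obtain F where F: "F \<in> \<G> k" "shifts (f k) \<subseteq> F" using f(2) by blast
    interpret tower G \<gamma> f k by (rule tow)
    note ls = level_sets[OF order_refl]
    have "\<exists>\<sigma>\<in>shifts (f k). \<forall>w\<in>V k. \<forall>l<k. z (w \<otimes> (\<sigma> \<otimes> g)) l = z w l" if g: "g \<in> carrier G" for g
    proof -
      let ?e = "shifts (f k) #> g"
      have e: "finite ?e" "?e \<subseteq> carrier G"
        using finite_translate[OF ls(4)] r_coset_subset_G[OF ls(5) g] by auto
      obtain j where j: "j > k" "?e \<subseteq> V j" using reachable[OF e] by blast
      have "V j \<subseteq> conflict (f k) <#> V j" using subset_set_mult_one[OF ls(14) V(1)] .
      then have "?e \<inter> (conflict (f k) <#> V j) = ?e" using j by blast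
      then have "2 * threshold (f k) < card (?e \<inter> (conflict (f k) <#> V j))"
        using f(1)[of k] card_translate[OF ls(5) g] by (simp add: level_ok_def)
      moreover have "robust k (f k) (V j) (p j)"
        using f(1)[of j] j by (simp add: level_ok_def V_def p_def)
      ultimately obtain \<sigma> where \<sigma>: "\<sigma> \<in> shifts (f k)" "occurs k (f k) (V j) (p j) (\<sigma> \<otimes> g)"
        using g unfolding robust_def by blast
      have "z (w \<otimes> (\<sigma> \<otimes> g)) l = z w l" if w: "w \<in> V k" "l < k" for w l
      proof -
        have "w \<otimes> (\<sigma> \<otimes> g) \<in> V j" "p j (w \<otimes> (\<sigma> \<otimes> g)) l = p k w l"
          using \<sigma>(2) w by (auto simp: occurs_def V_def p_def)
        then show ?thesis using z[of _ j l] z[OF w] j w by simp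
      qed
      then show ?thesis using \<sigma>(1) by blast
    qed
    note recur = this
    show "\<exists>F\<in>\<G> k. \<forall>g\<in>carrier G. \<exists>\<sigma>\<in>F. \<forall>w\<in>V k. \<forall>l<k. z (w \<otimes> (\<sigma> \<otimes> g)) l = z w l"
      by (rule bexI[OF ballI[OF bexE[OF recur]] F(1)]) (use F(2) in \<open>blast+\<close>)
  qed
qed

end

section \<open>The orbit closure\<close>

lemma point_nbhd_cylinder:
  fixes U :: "('g \<Rightarrow> nat \<Rightarrow> real) set"
  assumes "open U" "x \<in> U"
  shows "\<exists>W m. finite W \<and> (\<forall>y. (\<forall>w\<in>W. \<forall>l<m. y w l = x w l) \<longrightarrow> y \<in> U)"
proof -
  have "openin (product_topology (\<lambda>_. euclidean) UNIV) U"
    using assms by (simp add: euclidean_product_topology)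
  from product_topology_open_contains_basis[OF this assms(2)]
  obtain A where A: "x \<in> PiE UNIV A" "\<And>u. open (A u)" "finite {u. A u \<noteq> UNIV}" "PiE UNIV A \<subseteq> U" by auto
  define W where "W = {u. A u \<noteq> UNIV}"
  have "\<exists>m. \<forall>f. (\<forall>l<m. f l = x u l) \<longrightarrow> f \<in> A u" for u
  proof -
    have "openin (product_topology (\<lambda>_. euclidean) UNIV) (A u)"
      using A(2) by (simp add: euclidean_product_topology)
    from product_topology_open_contains_basis[OF this, of "x u"] A(1)
    obtain B where B: "x u \<in> PiE UNIV B" "finite {l. B l \<noteq> UNIV}" "PiE UNIV B \<subseteq> A u" by auto
    obtain m where m: "{l. B l \<noteq> UNIV} \<subseteq> {..<m}" using B(2) finite_nat_bounded by blast
    have "f \<in> A u" if f: "\<forall>l<m. f l = x u l" for f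
    proof -
      have "f l \<in> B l" for l
      proof (cases "l < m")
        case True
        then show ?thesis using B(1) f by (auto simp: PiE_iff)
      next
        case False
        then have "B l = UNIV" using m by auto
        then show ?thesis by simp
      qed
      then show ?thesis using B(3) by (auto simp: PiE_iff)
    qed
    then show ?thesis by blast
  qed
  then obtain m where m: "\<And>u f. (\<forall>l<m u. f l = x u l) \<Longrightarrow> f \<in> A u" by metis
  have W: "finite W" using A(3) by (simp add: W_def)
  show ?thesis
  proof (intro exI[of _ W] exI[of _ "Max (insert 0 (m ` W))"] conjI allI impI W)
    fix y assume y: "\<forall>w\<in>W. \<forall>l<Max (insert 0 (m ` W)). y w l = x w l"
    have "y u \<in> A u" for u
    proof (cases "u \<in> W")
      case True
      then have "m u \<le> Max (insert 0 (m ` W))" using W by (intro Max_ge) auto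
      then show ?thesis using y True by (intro m) auto
    next
      case False
      then show ?thesis by (simp add: W_def)
    qed
    then show "y \<in> U" using A(4) by (auto simp: PiE_iff)
  qed
qed

lemma continuous_map_pairwise_discrete:
  assumes "\<And>g. g \<in> A \<Longrightarrow> continuous_map X Y (f g)"
  shows "continuous_map (prod_topology (discrete_topology A) X) Y (\<lambda>(g, x). f g x)"
  unfolding continuous_map_def
proof (intro conjI allI impI)
  show "(\<lambda>(g, x). f g x) \<in> topspace (prod_topology (discrete_topology A) X) \<rightarrow> topspace Y"
    using assms by (auto simp: continuous_map_def Pi_iff)
  fix U assume U: "openin Y U"
  have "openin (prod_topology (discrete_topology A) X) ({g} \<times> {x \<in> topspace X. f g x \<in> U})" if "g \<in> A" for g
    using that openin_continuous_map_preimage[OF assms[OF that] U] by (simp add: openin_prod_Times_iff)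
  then have "openin (prod_topology (discrete_topology A) X) (\<Union>g\<in>A. {g} \<times> {x \<in> topspace X. f g x \<in> U})"
    by (intro openin_Union) auto
  moreover have "(\<Union>g\<in>A. {g} \<times> {x \<in> topspace X. f g x \<in> U}) =
      {p \<in> topspace (prod_topology (discrete_topology A) X). (\<lambda>(g, x). f g x) p \<in> U}"
    by auto
  ultimately show "openin (prod_topology (discrete_topology A) X)
      {p \<in> topspace (prod_topology (discrete_topology A) X). (\<lambda>(g, x). f g x) p \<in> U}" by simp
qed

lemma unbounded_family_image:
  assumes "unbounded_family \<F>" "\<And>F. F \<in> \<F> \<Longrightarrow> card (h F) = card F"
  shows "unbounded_family (h ` \<F>)"
  using assms by (simp add: unbounded_family_def image_image)

context group
begin

text \<open>Minimality of the orbit closure concerns open sets around every point \<open>g z\<close> of the orbit. A pattern of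
  \<open>g z\<close> on \<open>W\<close> is one of \<open>z\<close> on \<open>W g\<close>, and it recurs in \<open>z\<close> along \<open>F\<close> if the pattern of \<open>z\<close> recurs
  along \<open>g\<^sup>-\<^sup>1 F\<close>. So the construction is applied to the families of all sets \<open>g\<^sup>-\<^sup>1 F\<close>, each of
  them treated at infinitely many stages so as to cover all windows.\<close>

lemma ex_infinitely_recurrent_colouring:
  fixes \<F> :: "nat \<Rightarrow> 'a set set"
  assumes \<gamma>: "range \<gamma> = carrier G - {\<one>}" and count: "countable (carrier G)"
    and \<F>: "\<And>n. unbounded_family (\<F> n)" "\<And>n F. F \<in> \<F> n \<Longrightarrow> finite F \<and> F \<subseteq> carrier G"
  shows "\<exists>z :: 'a \<Rightarrow> nat \<Rightarrow> nat.
    (\<forall>u\<in>carrier G. \<forall>l. z u l < 3 \<and> z u l \<noteq> z (\<gamma> l \<otimes> u) l) \<and>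
    (\<forall>n. \<forall>W\<subseteq>carrier G. \<forall>m. \<forall>g\<in>carrier G. finite W \<longrightarrow>
      (\<exists>F\<in>\<F> n. \<forall>h\<in>carrier G. \<exists>\<sigma>\<in>F. \<forall>w\<in>W. \<forall>l<m. z (w \<otimes> (\<sigma> \<otimes> h)) l = z (w \<otimes> g) l))"
proof -
  define e where "e = from_nat_into (carrier G)"
  \<comment> \<open>stage \<open>k\<close> deals with a family and a group element; the second component of \<open>prod_decode k\<close> is free, so every pair is dealt with at arbitrarily late stages\<close>
  define task where "task k = prod_decode (fst (prod_decode k))" for k
  define \<G> where "\<G> k = (\<lambda>F. (\<lambda>\<sigma>. inv (e (snd (task k))) \<otimes> \<sigma>) ` F) ` \<F> (fst (task k))" for k
  have e: "e i \<in> carrier G" for i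
    unfolding e_def by (rule from_nat_into) blast
  have card_eq: "card ((\<lambda>\<sigma>. inv (e i) \<otimes> \<sigma>) ` F) = card F" if "F \<in> \<F> n" for i n F
  proof (rule card_image, rule inj_onI)
    fix x y assume "x \<in> F" "y \<in> F" "inv (e i) \<otimes> x = inv (e i) \<otimes> y"
    moreover from this have "x \<in> carrier G" "y \<in> carrier G" using \<F>(2)[OF that] by auto
    ultimately show "x = y" using e[of i] by simp
  qed
  have "\<exists>(z :: 'a \<Rightarrow> nat \<Rightarrow> nat) V. incseq V \<and> (\<Union>k. V k) = carrier G \<and>
    (\<forall>u\<in>carrier G. \<forall>l. z u l < 3 \<and> z u l \<noteq> z (\<gamma> l \<otimes> u) l) \<and>
    (\<forall>k. \<exists>F\<in>\<G> k. \<forall>g\<in>carrier G. \<exists>\<sigma>\<in>F. \<forall>w\<in>V k. \<forall>l<k. z (w \<otimes> (\<sigma> \<otimes> g)) l = z w l)"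
  proof (rule ex_recurrent_colouring[OF \<gamma>])
    show "unbounded_family (\<G> k)" for k
      unfolding \<G>_def using \<F>(1) card_eq by (rule unbounded_family_image)
    show "finite F \<and> F \<subseteq> carrier G" if FG: "F \<in> \<G> k" for k F
    proof -
      obtain F0 where F0: "F0 \<in> \<F> (fst (task k))" "F = (\<lambda>\<sigma>. inv (e (snd (task k))) \<otimes> \<sigma>) ` F0"
        using FG unfolding \<G>_def by blast
      have "inv (e (snd (task k))) \<otimes> \<sigma> \<in> carrier G" if "\<sigma> \<in> F0" for \<sigma>
        using \<F>(2)[OF F0(1)] e that by (intro m_closed inv_closed) auto
      then show ?thesis using F0 \<F>(2)[OF F0(1)] by auto
    qed
  qed
  then obtain z :: "'a \<Rightarrow> nat \<Rightarrow> nat" and V where V: "incseq V" "(\<Union>k. V k) = carrier G"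
    and z: "\<forall>u\<in>carrier G. \<forall>l. z u l < 3 \<and> z u l \<noteq> z (\<gamma> l \<otimes> u) l"
    and rec: "\<forall>k. \<exists>F\<in>\<G> k. \<forall>g\<in>carrier G. \<exists>\<sigma>\<in>F. \<forall>w\<in>V k. \<forall>l<k. z (w \<otimes> (\<sigma> \<otimes> g)) l = z w l"
    by (elim exE conjE) (rule that)
  have exhaust: "\<exists>b. X \<subseteq> V b" if "finite X" "X \<subseteq> carrier G" for X
    using that
  proof (induction X rule: finite_induct)
    case (insert x X)
    then obtain j where j: "X \<subseteq> V j" by auto
    obtain i where "x \<in> V i" using V(2) insert.prems by blast
    moreover have "V i \<subseteq> V (max i j)" "V j \<subseteq> V (max i j)"
      by (rule incseqD[OF V(1)]; simp)+
    ultimately have "insert x X \<subseteq> V (max i j)" using j by blast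
    then show ?case by blast
  qed simp
  have main: "\<exists>F\<in>\<F> n. \<forall>h\<in>carrier G. \<exists>\<sigma>\<in>F. \<forall>w\<in>W. \<forall>l<m. z (w \<otimes> (\<sigma> \<otimes> h)) l = z (w \<otimes> g) l"
    if W: "W \<subseteq> carrier G" "finite W" and g: "g \<in> carrier G" for n W m g
  proof -
    have "W #> g \<subseteq> carrier G" using W g by (intro r_coset_subset_G) auto
    then obtain b where b: "W #> g \<subseteq> V b" using exhaust[of "W #> g"] finite_translate[OF W(2)] by auto
    define i where "i = to_nat_on (carrier G) g"
    have ei: "e i = g" unfolding e_def i_def by (rule from_nat_into_to_nat_on[OF count g])
    define k where "k = prod_encode (prod_encode (n, i), max b m)"
    have task: "task k = (n, i)" by (simp add: task_def k_def)
    have k: "b \<le> k" "m \<le> k"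
      using le_prod_encode_2[of "max b m" "prod_encode (n, i)"] by (simp_all add: k_def)
    have Vk: "W #> g \<subseteq> V k" using b incseqD[OF V(1) k(1)] by blast
    obtain F' where "F' \<in> \<G> k"
      and F': "\<forall>h\<in>carrier G. \<exists>\<sigma>\<in>F'. \<forall>w\<in>V k. \<forall>l<k. z (w \<otimes> (\<sigma> \<otimes> h)) l = z w l"
      using rec by blast
    then obtain F where F: "F \<in> \<F> n" "F' = (\<lambda>\<sigma>. inv g \<otimes> \<sigma>) ` F"
      by (auto simp: \<G>_def task ei)
    have "\<exists>\<sigma>\<in>F. \<forall>w\<in>W. \<forall>l<m. z (w \<otimes> (\<sigma> \<otimes> h)) l = z (w \<otimes> g) l" if h: "h \<in> carrier G" for h
    proof -
      obtain \<tau> where "\<tau> \<in> F'" and \<tau>: "\<forall>w\<in>V k. \<forall>l<k. z (w \<otimes> (\<tau> \<otimes> h)) l = z w l"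
        using F' h by blast
      then obtain \<sigma> where \<sigma>: "\<sigma> \<in> F" "\<tau> = inv g \<otimes> \<sigma>" using F by blast
      have \<sigma>c: "\<sigma> \<in> carrier G" using \<sigma> \<F>(2)[OF F(1)] by auto
      have "z (w \<otimes> (\<sigma> \<otimes> h)) l = z (w \<otimes> g) l" if w: "w \<in> W" "l < m" for w l
      proof -
        have wc: "w \<in> carrier G" using w W by auto
        have "(w \<otimes> g) \<otimes> (\<tau> \<otimes> h) = w \<otimes> ((g \<otimes> inv g) \<otimes> (\<sigma> \<otimes> h))"
          unfolding \<sigma>(2) using wc g \<sigma>c h by (simp only: m_assoc m_closed inv_closed)
        then have "(w \<otimes> g) \<otimes> (\<tau> \<otimes> h) = w \<otimes> (\<sigma> \<otimes> h)" using g \<sigma>c h by simp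
        moreover have "w \<otimes> g \<in> V k" using Vk w translateI by blast
        ultimately show ?thesis using \<tau> w k by force
      qed
      then show ?thesis using \<sigma>(1) by blast
    qed
    then show ?thesis using F(1) by blast
  qed
  show ?thesis
    by (rule exI[of _ z]) (use z main in blast)
qed

definition shift :: "'a \<Rightarrow> 'a point \<Rightarrow> 'a point" where
  "shift g x = (\<lambda>u. if u \<in> carrier G then x (u \<otimes> g) else (\<lambda>_. 0))"

lemma shift_mult:
  assumes "g \<in> carrier G" "h \<in> carrier G"
  shows "shift (g \<otimes> h) x = shift g (shift h x)"
  using assms by (auto simp: shift_def fun_eq_iff m_assoc)

lemma continuous_shift: "continuous_on UNIV (shift g)"
proof (rule continuous_on_coordinatewise_then_product)
  fix u
  show "continuous_on UNIV (\<lambda>x. shift g x u)"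
    by (cases "u \<in> carrier G") (simp_all add: shift_def)
qed

lemma Hausdorff_points: "Hausdorff_space (euclidean :: 'a point topology)"
proof -
  have "Hausdorff_space (product_topology (\<lambda>_::'a. product_topology (\<lambda>_::nat. euclideanreal) UNIV) UNIV)"
    by (simp add: Hausdorff_space_product_topology)
  then show ?thesis by (simp add: euclidean_product_topology)
qed

text \<open>Points vanish outside the carrier, so that the identity of the group acts as the identity.\<close>

definition tricoloured :: "'a point set" where
  "tricoloured = (\<Pi>\<^sub>E u\<in>UNIV. if u \<in> carrier G then (\<Pi>\<^sub>E l\<in>UNIV. {0, 1, 2}) else {\<lambda>_. 0})"

lemma compactin_tricoloured: "compactin euclidean tricoloured"
proof -
  have "compactin (product_topology (\<lambda>_::nat. euclideanreal) UNIV) (\<Pi>\<^sub>E l\<in>UNIV. {0, 1, 2})"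
    by (simp add: compactin_PiE)
  then have "compactin euclidean (\<Pi>\<^sub>E l\<in>(UNIV::nat set). {0, 1, 2::real})"
    by (simp add: euclidean_product_topology)
  then have "compactin (product_topology (\<lambda>_::'a. euclidean) UNIV) tricoloured"
    unfolding tricoloured_def by (subst compactin_PiE) (auto simp del: compactin_euclidean_iff)
  then show ?thesis by (simp only: euclidean_product_topology)
qed

lemma closed_tricoloured: "closed tricoloured"
  using compactin_imp_closedin[OF Hausdorff_points compactin_tricoloured] by simp

text \<open>Elements of \<open>BijGroup E\<close> are extensional functions, which explains the restriction.\<close>

lemma group_action_restrict:
  assumes "\<And>g x. g \<in> carrier G \<Longrightarrow> x \<in> E \<Longrightarrow> a g x \<in> E"
    and "\<And>x. x \<in> E \<Longrightarrow> a \<one> x = x"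
    and "\<And>g h x. g \<in> carrier G \<Longrightarrow> h \<in> carrier G \<Longrightarrow> x \<in> E \<Longrightarrow> a (g \<otimes> h) x = a g (a h x)"
  shows "group_action G E (\<lambda>g. restrict (a g) E)"
proof -
  have Bij: "restrict (a g) E \<in> Bij E" if g: "g \<in> carrier G" for g
  proof -
    have "bij_betw (restrict (a g) E) E E"
    proof (rule bij_betwI[where g = "a (inv g)"])
      show "a (inv g) (restrict (a g) E x) = x" if "x \<in> E" for x
        using assms(3)[of "inv g" g x] assms(2) that g by simp
      show "restrict (a g) E (a (inv g) x) = x" if "x \<in> E" for x
        using assms(3)[of g "inv g" x] assms(1)[of "inv g" x] assms(2) that g by simp
    qed (use assms(1) g in auto)
    then show ?thesis by (simp add: Bij_def)
  qed
  have "(\<lambda>g. restrict (a g) E) \<in> hom G (BijGroup E)"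
  proof (rule homI)
    fix g h assume gh: "g \<in> carrier G" "h \<in> carrier G"
    have "restrict (a (g \<otimes> h)) E = compose E (restrict (a g) E) (restrict (a h) E)"
      using assms gh by (auto simp: fun_eq_iff compose_def)
    then show "restrict (a (g \<otimes> h)) E = restrict (a g) E \<otimes>\<^bsub>BijGroup E\<^esub> restrict (a h) E"
      using Bij gh by (simp add: BijGroup_def)
  qed (simp add: Bij BijGroup_def)
  then show ?thesis
    by (intro group_action.intro group_hom.intro group_hom_axioms.intro group_BijGroup is_group)
qed

text \<open>Every point of the orbit closure agrees with some \<open>h z\<close> on any finite set of coordinates (\<open>approx\<close> below).
  Freeness and minimality are statements about finitely many coordinates at a time, so they follow
  from the colouring condition and the recurrence of \<open>z\<close>.\<close>

lemma orbit_closure_flow: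
  fixes z :: "'a \<Rightarrow> nat \<Rightarrow> nat" and \<F> :: "nat \<Rightarrow> 'a set set"
  assumes \<gamma>: "range \<gamma> = carrier G - {\<one>}"
    and \<F>: "\<And>n F. F \<in> \<F> n \<Longrightarrow> finite F \<and> F \<subseteq> carrier G"
    and colouring: "\<forall>u\<in>carrier G. \<forall>l. z u l < 3 \<and> z u l \<noteq> z (\<gamma> l \<otimes> u) l"
    and recurrence: "\<forall>n. \<forall>W\<subseteq>carrier G. \<forall>m. \<forall>g\<in>carrier G. finite W \<longrightarrow>
      (\<exists>F\<in>\<F> n. \<forall>h\<in>carrier G. \<exists>\<sigma>\<in>F. \<forall>w\<in>W. \<forall>l<m. z (w \<otimes> (\<sigma> \<otimes> h)) l = z (w \<otimes> g) l)"
  shows "\<exists>(X :: 'a point topology) \<phi>.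
    flow G X \<phi> \<and> free_action G (topspace X) \<phi> \<and> (\<forall>n. family_minimal G X \<phi> (\<F> n))"
proof -
  have z: "z u l < 3 \<and> z u l \<noteq> z (\<gamma> l \<otimes> u) l" if "u \<in> carrier G" for u l
    using colouring that by blast
  have recurs: "\<exists>F\<in>\<F> n. \<forall>h\<in>carrier G. \<exists>\<sigma>\<in>F. \<forall>w\<in>W. \<forall>l<m. z (w \<otimes> (\<sigma> \<otimes> h)) l = z (w \<otimes> g) l"
    if "W \<subseteq> carrier G" "finite W" "g \<in> carrier G" for n W m g
    using recurrence that by blast
  define x0 :: "'a point" where "x0 = (\<lambda>u l. if u \<in> carrier G then real (z u l) else 0)"
  define Orb where "Orb = (\<lambda>g. shift g x0) ` carrier G"
  define \<Omega> where "\<Omega> = closure Orb"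
  define X where "X = top_of_set \<Omega>"
  define \<phi> where "\<phi> g = restrict (shift g) \<Omega>" for g
  have topX: "topspace X = \<Omega>" by (simp add: X_def)
  have shift_x0: "shift g x0 u l = (if u \<in> carrier G then real (z (u \<otimes> g) l) else 0)"
    if "g \<in> carrier G" for g u l
    using that by (simp add: shift_def x0_def)
  have "Orb \<subseteq> tricoloured"
  proof -
    have "real (z (u \<otimes> g) l) \<in> {0, 1, 2}" if "u \<in> carrier G" "g \<in> carrier G" for u g l
    proof -
      have "z (u \<otimes> g) l < 3" using z[of "u \<otimes> g" l] that by simp
      then have "z (u \<otimes> g) l = 0 \<or> z (u \<otimes> g) l = 1 \<or> z (u \<otimes> g) l = 2" by arith
      then show ?thesis by auto
    qed
    note val = this
    have "shift g x0 u \<in> (if u \<in> carrier G then (\<Pi>\<^sub>E l\<in>UNIV. {0, 1, 2}) else {\<lambda>_. 0})"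
      if "g \<in> carrier G" for g u
    proof (cases "u \<in> carrier G")
      case True
      then show ?thesis using val[OF True that] that by (simp add: PiE_iff shift_x0)
    qed (simp add: shift_def)
    then show ?thesis unfolding Orb_def tricoloured_def PiE_iff by auto
  qed
  then have \<Omega>tri: "\<Omega> \<subseteq> tricoloured" unfolding \<Omega>_def using closed_tricoloured by (rule closure_minimal)
  have "compactin euclidean \<Omega>"
    using closed_compactin[OF compactin_tricoloured \<Omega>tri] by (simp add: \<Omega>_def)
  then have compX: "compact_space X" unfolding X_def by (rule compact_space_subtopology)
  have HausX: "Hausdorff_space X" unfolding X_def by (rule Hausdorff_space_subtopology[OF Hausdorff_points])
  have "shift \<one> x0 \<in> Orb" unfolding Orb_def by blast
  then have neX: "topspace X \<noteq> {}" unfolding topX \<Omega>_def using closure_subset[of Orb] by blast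
  have approx: "\<exists>h\<in>carrier G. \<forall>w\<in>W. \<forall>l<m. x w l = real (z (w \<otimes> h) l)"
    if x: "x \<in> \<Omega>" and W: "finite W" "W \<subseteq> carrier G" for x W m
  proof -
    \<comment> \<open>values are integers, so agreement up to an error below \<open>1\<close> is equality\<close>
    define N where "N = (\<Inter>w\<in>W. \<Inter>l\<in>{..<m}. (\<lambda>y. y w l) -` ball (x w l) 1)"
    have cont: "continuous_on UNIV (\<lambda>y :: 'a point. y w l)" for w l
      by (rule continuous_on_product_then_coordinatewise[OF continuous_on_product_coordinates])
    have "open N" unfolding N_def
      using W cont by (intro open_INT ballI finite_lessThan open_vimage open_ball) auto
    moreover have "x \<in> N" by (simp add: N_def)
    ultimately have "N \<inter> Orb \<noteq> {}" using x open_Int_closure_eq_empty[of N Orb] unfolding \<Omega>_def by blast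
    then obtain h where h: "h \<in> carrier G" "shift h x0 \<in> N" unfolding Orb_def by blast
    have "x w l = real (z (w \<otimes> h) l)" if wl: "w \<in> W" "l < m" for w l
    proof -
      have wc: "w \<in> carrier G" using wl W by auto
      have "\<bar>x w l - real (z (w \<otimes> h) l)\<bar> < 1"
        using h wl wc by (auto simp: N_def shift_x0 dist_real_def)
      moreover have "x w \<in> (if w \<in> carrier G then (\<Pi>\<^sub>E l\<in>UNIV. {0, 1, 2}) else {\<lambda>_. 0})"
        using \<Omega>tri x unfolding tricoloured_def PiE_iff by blast
      then have "x w l = of_int 0 \<or> x w l = of_int 1 \<or> x w l = of_int 2"
        using wc by (simp add: PiE_iff)
      then obtain c :: int where c: "x w l = of_int c" by blast
      have "of_int c - real (z (w \<otimes> h) l) = real_of_int (c - int (z (w \<otimes> h) l))" by simp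
      ultimately have "\<bar>c - int (z (w \<otimes> h) l)\<bar> < 1" unfolding c by linarith
      then show ?thesis using c by simp
    qed
    then show ?thesis using h by blast
  qed
  have shift_\<Omega>: "shift g x \<in> \<Omega>" if g: "g \<in> carrier G" and x: "x \<in> \<Omega>" for g x
  proof -
    have "shift g ` closure Orb \<subseteq> closure (shift g ` Orb)"
      using continuous_map_image_closure_subset[of euclidean euclidean "shift g" Orb] continuous_shift
      by simp
    moreover have "shift g ` Orb \<subseteq> Orb"
      using g by (auto simp: Orb_def shift_mult[symmetric])
    ultimately have "shift g ` closure Orb \<subseteq> closure Orb" using closure_mono by blast
    then show ?thesis using x by (auto simp: \<Omega>_def)
  qed
  have shift_one: "shift \<one> x = x" if "x \<in> \<Omega>" for x
  proof
    fix u
    show "shift \<one> x u = x u"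
    proof (cases "u \<in> carrier G")
      case False
      have "x u \<in> (if u \<in> carrier G then (\<Pi>\<^sub>E l\<in>UNIV. {0, 1, 2}) else {\<lambda>_. 0})"
        using \<Omega>tri that unfolding tricoloured_def by blast
      then show ?thesis using False by (simp add: shift_def)
    qed (simp add: shift_def)
  qed
  have action: "group_action G (topspace X) \<phi>"
    unfolding topX \<phi>_def
    by (rule group_action_restrict) (auto simp: shift_\<Omega> shift_one shift_mult)
  have cont_\<phi>: "continuous_map X X (\<phi> g)" if g: "g \<in> carrier G" for g
  proof -
    have "continuous_on \<Omega> (\<phi> g)"
      using continuous_on_subset[OF continuous_shift subset_UNIV, of \<Omega> g]
      by (rule continuous_on_eq) (simp add: \<phi>_def)
    then show ?thesis using shift_\<Omega>[OF g] unfolding X_def by (simp add: \<phi>_def)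
  qed
  have joint: "continuous_map (prod_topology (discrete_topology (carrier G)) X) X (\<lambda>(g, x). \<phi> g x)"
  proof (rule continuous_map_pairwise_discrete)
    show "continuous_map X X (\<phi> g)" if "g \<in> carrier G" for g using cont_\<phi>[OF that] .
  qed
  have "flow G X \<phi>"
    using action neX compX HausX joint by (intro flow.intro flow_axioms.intro)
  moreover have "free_action G (topspace X) \<phi>"
    unfolding free_action_def
  proof (intro ballI impI)
    fix x g assume x: "x \<in> topspace X" and g: "g \<in> carrier G" "g \<noteq> \<one>"
    obtain l where l: "g = \<gamma> l" using \<gamma> g by blast
    have "x \<in> \<Omega>" "finite {\<one>, g}" "{\<one>, g} \<subseteq> carrier G" using x g topX by auto
    from approx[OF this] obtain h where h: "h \<in> carrier G"
        "\<forall>w\<in>{\<one>, g}. \<forall>j<Suc l. x w j = real (z (w \<otimes> h) j)" by blast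
    then have "x \<one> l = real (z h l)" "x g l = real (z (\<gamma> l \<otimes> h) l)" by (simp_all add: l)
    then have "x g l \<noteq> x \<one> l" using z[OF h(1), of l] by simp
    moreover have "\<phi> g x \<one> l = x g l" using x g by (simp add: \<phi>_def shift_def topX)
    ultimately show "\<phi> g x \<noteq> x" by metis
  qed
  moreover have "family_minimal G X \<phi> (\<F> n)" for n
    unfolding family_minimal_def
  proof (intro allI impI)
    fix U assume U: "openin X U \<and> U \<noteq> {}"
    then obtain U' where U': "open U'" "U = \<Omega> \<inter> U'" unfolding X_def by (auto simp: openin_open)
    then have "U' \<inter> Orb \<noteq> {}"
      using U open_Int_closure_eq_empty[of U' Orb] unfolding \<Omega>_def by blast
    then obtain g where g: "g \<in> carrier G" "shift g x0 \<in> U'" unfolding Orb_def by blast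
    obtain W m where W: "finite W" and cyl: "\<And>y. (\<forall>w\<in>W. \<forall>l<m. y w l = shift g x0 w l) \<Longrightarrow> y \<in> U'"
      using point_nbhd_cylinder[OF U'(1) g(2)] by blast
    define W' where "W' = W \<inter> carrier G"
    have W': "finite W'" "W' \<subseteq> carrier G" using W by (auto simp: W'_def)
    obtain F where F: "F \<in> \<F> n"
      and rec: "\<And>h. h \<in> carrier G \<Longrightarrow> \<exists>\<sigma>\<in>F. \<forall>w\<in>W'. \<forall>l<m. z (w \<otimes> (\<sigma> \<otimes> h)) l = z (w \<otimes> g) l"
      using recurs[OF W'(2,1) g(1), of n m] by blast
    have Ff: "finite F" "F \<subseteq> carrier G" using \<F>[OF F] by auto
    have "\<exists>\<sigma>\<in>F. \<phi> \<sigma> x \<in> U" if x: "x \<in> topspace X" for x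
    proof -
      have "x \<in> \<Omega>" using x topX by simp
      from approx[OF this finite_set_mult[OF W'(1) Ff(1)] set_mult_closed[OF W'(2) Ff(2)], of m]
      obtain h where h: "h \<in> carrier G" "\<forall>w\<in>W' <#> F. \<forall>l<m. x w l = real (z (w \<otimes> h) l)"
        by (rule bexE)
      obtain \<sigma> where \<sigma>: "\<sigma> \<in> F" "\<forall>w\<in>W'. \<forall>l<m. z (w \<otimes> (\<sigma> \<otimes> h)) l = z (w \<otimes> g) l" using rec[OF h(1)] by blast
      have \<sigma>c: "\<sigma> \<in> carrier G" using \<sigma> Ff by auto
      have "shift \<sigma> x w l = shift g x0 w l" if wl: "w \<in> W" "l < m" for w l
      proof (cases "w \<in> carrier G")
        case True
        then have w': "w \<in> W'" using wl by (simp add: W'_def)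
        have "shift \<sigma> x w l = real (z ((w \<otimes> \<sigma>) \<otimes> h) l)"
          using bspec[OF h(2) set_multI[OF w' \<sigma>(1)]] wl(2) True by (simp add: shift_def)
        also have "(w \<otimes> \<sigma>) \<otimes> h = w \<otimes> (\<sigma> \<otimes> h)" using True \<sigma>c h by (simp add: m_assoc)
        also have "z (w \<otimes> (\<sigma> \<otimes> h)) l = z (w \<otimes> g) l" using \<sigma>(2) w' wl by blast
        finally show ?thesis using True g by (simp add: shift_x0)
      next
        case False
        then show ?thesis by (simp add: shift_def)
      qed
      then have "shift \<sigma> x \<in> U'" using cyl by blast
      then have "\<phi> \<sigma> x \<in> U" using U' shift_\<Omega>[OF \<sigma>c] x by (simp add: \<phi>_def topX)
      then show ?thesis using \<sigma>(1) by blast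
    qed
    moreover have "U \<subseteq> topspace X" using U by (auto dest: openin_subset)
    ultimately have "syndetic G (topspace X) \<phi> F U"
      by (simp add: group_action.syndetic_iff[OF action Ff(2)])
    then show "\<exists>F\<in>\<F> n. syndetic G (topspace X) \<phi> F U" using F by blast
  qed
  ultimately show ?thesis by blast
qed

end

theorem theorem1p10:
  fixes G :: "('g, 'm) monoid_scheme" and \<F> :: "nat \<Rightarrow> 'g set set"
  assumes "group G" and "countable (carrier G)" and "infinite (carrier G)"
    and "\<And>n F. F \<in> \<F> n \<Longrightarrow> finite F \<and> F \<subseteq> carrier G"
    and "\<And>n. unbounded_family (\<F> n)"
  shows "\<exists>(X :: 'g point topology) \<phi>.
           flow G X \<phi> \<and> free_action G (topspace X) \<phi> \<and> (\<forall>n. family_minimal G X \<phi> (\<F> n))"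
proof -
  interpret group G by fact
  let ?\<gamma> = "from_nat_into (carrier G - {\<one>\<^bsub>G\<^esub>})"
  have "infinite (carrier G - {\<one>\<^bsub>G\<^esub>})" using assms(3) by simp
  then have "carrier G - {\<one>\<^bsub>G\<^esub>} \<noteq> {}" by (metis finite.emptyI)
  then have \<gamma>: "range ?\<gamma> = carrier G - {\<one>\<^bsub>G\<^esub>}"
    using assms(2) by (intro range_from_nat_into) auto
  have "\<exists>z :: 'g \<Rightarrow> nat \<Rightarrow> nat.
    (\<forall>u\<in>carrier G. \<forall>l. z u l < 3 \<and> z u l \<noteq> z (?\<gamma> l \<otimes>\<^bsub>G\<^esub> u) l) \<and>
    (\<forall>n. \<forall>W\<subseteq>carrier G. \<forall>m. \<forall>g\<in>carrier G. finite W \<longrightarrow>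
      (\<exists>F\<in>\<F> n. \<forall>h\<in>carrier G. \<exists>\<sigma>\<in>F. \<forall>w\<in>W. \<forall>l<m.
        z (w \<otimes>\<^bsub>G\<^esub> (\<sigma> \<otimes>\<^bsub>G\<^esub> h)) l = z (w \<otimes>\<^bsub>G\<^esub> g) l))"
    by (rule ex_infinitely_recurrent_colouring[OF \<gamma> assms(2)]) (use assms(4,5) in auto)
  then show ?thesis
    by (elim exE conjE) (rule orbit_closure_flow[OF \<gamma> assms(4)])
qed

end
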